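(* Let $1<p<\infty$ with $p\neq2$. There exist trivial isomorphic extensions $\phi_1,\phi_2$ of $K(l^p)$ by $C[0,1]$ that are not equivalent. Moreover, $[\phi_1]\neq[\phi_2]+[\phi_3]$ for every isomorphic extension $\phi_3$ of $K(l^p)$ by $C[0,1]$.
   Context: $\pi:B(l^p)\to B(l^p)/K(l^p)$ is the quotient map. A homomorphism of Banach algebras is an isomorphism (into) if it is bounded above and below by constant multiples of the norm. An isomorphic extension of $K(l^p)$ by $C[0,1]$ is a unital isomorphism (into) $\phi:C[0,1]\to B(l^p)/K(l^p)$; it is trivial if $\phi=\pi\circ\rho$ for a unital isomorphism (into) $\rho:C[0,1]\to B(l^p)$. $\phi_1,\phi_2$ are equivalent if there is an invertible $S\in B(l^p)$ with $\phi_2(a)=\pi(S)\phi_1(a)\pi(S)^{-1}$ for all $a$; $[\phi]$ is the equivalence class, and $[\phi_1]+[\phi_2]$ is the class of $a\mapsto\pi(S_0(T_1\oplus T_2)S_0^{-1})$ where $\pi(T_i)=\phi_i(a)$ and $S_0:l^p\oplus l^p\to l^p$ is any invertible operator. *)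

theory Defs
  imports Complex_Main
begin

(* Scalars are complex. Sequences nat => complex; operators are maps on
   sequences, only their behaviour on l^p matters. *)

type_synonym seq = "nat \<Rightarrow> complex"
type_synonym bop = "seq \<Rightarrow> seq"

definition lp :: "real \<Rightarrow> seq set" where
  "lp p = {x. summable (\<lambda>n. cmod (x n) powr p)}"

definition lpnorm :: "real \<Rightarrow> seq \<Rightarrow> real" where
  "lpnorm p x = (\<Sum>n. cmod (x n) powr p) powr (1 / p)"

definition seq_add :: "seq \<Rightarrow> seq \<Rightarrow> seq" where
  "seq_add x y = (\<lambda>n. x n + y n)"

definition seq_scale :: "complex \<Rightarrow> seq \<Rightarrow> seq" where
  "seq_scale c x = (\<lambda>n. c * x n)"

definition seq_diff :: "seq \<Rightarrow> seq \<Rightarrow> seq" where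
  "seq_diff x y = (\<lambda>n. x n - y n)"

definition bounded_op :: "real \<Rightarrow> bop \<Rightarrow> bool" where
  "bounded_op p T \<longleftrightarrow>
     (\<forall>x\<in>lp p. T x \<in> lp p) \<and>
     (\<forall>x\<in>lp p. \<forall>y\<in>lp p. T (seq_add x y) = seq_add (T x) (T y)) \<and>
     (\<forall>x\<in>lp p. \<forall>c. T (seq_scale c x) = seq_scale c (T x)) \<and>
     (\<exists>M. \<forall>x\<in>lp p. lpnorm p (T x) \<le> M * lpnorm p x)"

definition op_eq :: "real \<Rightarrow> bop \<Rightarrow> bop \<Rightarrow> bool" where
  "op_eq p T S \<longleftrightarrow> (\<forall>x\<in>lp p. T x = S x)"

definition op_add :: "bop \<Rightarrow> bop \<Rightarrow> bop" where
  "op_add T S = (\<lambda>x. seq_add (T x) (S x))"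

definition op_scale :: "complex \<Rightarrow> bop \<Rightarrow> bop" where
  "op_scale c T = (\<lambda>x. seq_scale c (T x))"

definition opnorm :: "real \<Rightarrow> bop \<Rightarrow> real" where
  "opnorm p T = Sup {lpnorm p (T x) | x. x \<in> lp p \<and> lpnorm p x \<le> 1}"

definition compact_op :: "real \<Rightarrow> bop \<Rightarrow> bool" where
  "compact_op p K \<longleftrightarrow> bounded_op p K \<and>
     (\<forall>x :: nat \<Rightarrow> seq. (\<forall>n. x n \<in> lp p \<and> lpnorm p (x n) \<le> 1) \<longrightarrow>
        (\<exists>r y. strict_mono r \<and> y \<in> lp p \<and>
           (\<lambda>n. lpnorm p (seq_diff (K (x (r n))) y)) \<longlonglongrightarrow> 0))"

definition calkin_pi :: "real \<Rightarrow> bop \<Rightarrow> bop set" where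
  "calkin_pi p T = {S. bounded_op p S \<and> compact_op p (\<lambda>x. seq_diff (S x) (T x))}"

definition calkin :: "real \<Rightarrow> bop set set" where
  "calkin p = calkin_pi p ` {T. bounded_op p T}"

definition rep :: "bop set \<Rightarrow> bop" where
  "rep A = (SOME T. T \<in> A)"

definition calkin_norm :: "real \<Rightarrow> bop set \<Rightarrow> real" where
  "calkin_norm p A = Inf (opnorm p ` A)"

definition C01 :: "(real \<Rightarrow> complex) set" where
  "C01 = {f. continuous_on {0..1} f}"

definition supnorm :: "(real \<Rightarrow> complex) \<Rightarrow> real" where
  "supnorm f = Sup ((\<lambda>t. cmod (f t)) ` {0..1})"

definition iso_ext :: "real \<Rightarrow> ((real \<Rightarrow> complex) \<Rightarrow> bop set) \<Rightarrow> bool" where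
  "iso_ext p \<phi> \<longleftrightarrow>
     (\<forall>f\<in>C01. \<phi> f \<in> calkin p) \<and>
     (\<forall>f\<in>C01. \<forall>g\<in>C01. \<phi> (\<lambda>t. f t + g t) = calkin_pi p (op_add (rep (\<phi> f)) (rep (\<phi> g)))) \<and>
     (\<forall>f\<in>C01. \<forall>c. \<phi> (\<lambda>t. c * f t) = calkin_pi p (op_scale c (rep (\<phi> f)))) \<and>
     (\<forall>f\<in>C01. \<forall>g\<in>C01. \<phi> (\<lambda>t. f t * g t) = calkin_pi p (rep (\<phi> f) \<circ> rep (\<phi> g))) \<and>
     \<phi> (\<lambda>t. 1) = calkin_pi p id \<and>
     (\<exists>c C. c > 0 \<and> (\<forall>f\<in>C01. c * supnorm f \<le> calkin_norm p (\<phi> f) \<and>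
                                 calkin_norm p (\<phi> f) \<le> C * supnorm f))"

definition iso_lift :: "real \<Rightarrow> ((real \<Rightarrow> complex) \<Rightarrow> bop) \<Rightarrow> bool" where
  "iso_lift p \<rho> \<longleftrightarrow>
     (\<forall>f\<in>C01. bounded_op p (\<rho> f)) \<and>
     (\<forall>f\<in>C01. \<forall>g\<in>C01. op_eq p (\<rho> (\<lambda>t. f t + g t)) (op_add (\<rho> f) (\<rho> g))) \<and>
     (\<forall>f\<in>C01. \<forall>c. op_eq p (\<rho> (\<lambda>t. c * f t)) (op_scale c (\<rho> f))) \<and>
     (\<forall>f\<in>C01. \<forall>g\<in>C01. op_eq p (\<rho> (\<lambda>t. f t * g t)) (\<rho> f \<circ> \<rho> g)) \<and>
     op_eq p (\<rho> (\<lambda>t. 1)) id \<and>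
     (\<exists>c C. c > 0 \<and> (\<forall>f\<in>C01. c * supnorm f \<le> opnorm p (\<rho> f) \<and>
                                 opnorm p (\<rho> f) \<le> C * supnorm f))"

definition trivial_ext :: "real \<Rightarrow> ((real \<Rightarrow> complex) \<Rightarrow> bop set) \<Rightarrow> bool" where
  "trivial_ext p \<phi> \<longleftrightarrow> iso_ext p \<phi> \<and>
     (\<exists>\<rho>. iso_lift p \<rho> \<and> (\<forall>f\<in>C01. \<phi> f = calkin_pi p (\<rho> f)))"

definition ext_equiv :: "real \<Rightarrow> ((real \<Rightarrow> complex) \<Rightarrow> bop set) \<Rightarrow> ((real \<Rightarrow> complex) \<Rightarrow> bop set) \<Rightarrow> bool" where
  "ext_equiv p \<phi>1 \<phi>2 \<longleftrightarrow>
     (\<exists>S Sinv. bounded_op p S \<and> bounded_op p Sinv \<and>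
        op_eq p (S \<circ> Sinv) id \<and> op_eq p (Sinv \<circ> S) id \<and>
        (\<forall>f\<in>C01. \<phi>2 f = calkin_pi p (S \<circ> rep (\<phi>1 f) \<circ> Sinv)))"

(* S0 (T1 (+) T2) S0^-1 for the interleaving isomorphism
   S0 : l^p (+) l^p -> l^p, S0(u,v) = (u0,v0,u1,v1,...) *)
definition interleave :: "seq \<Rightarrow> seq \<Rightarrow> seq" where
  "interleave u v = (\<lambda>n. if even n then u (n div 2) else v (n div 2))"

definition evens :: "seq \<Rightarrow> seq" where
  "evens x = (\<lambda>n. x (2 * n))"

definition odds :: "seq \<Rightarrow> seq" where
  "odds x = (\<lambda>n. x (2 * n + 1))"

definition op_dsum :: "bop \<Rightarrow> bop \<Rightarrow> bop" where
  "op_dsum T1 T2 = (\<lambda>x. interleave (T1 (evens x)) (T2 (odds x)))"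

definition ext_sum :: "real \<Rightarrow> ((real \<Rightarrow> complex) \<Rightarrow> bop set) \<Rightarrow> ((real \<Rightarrow> complex) \<Rightarrow> bop set) \<Rightarrow> (real \<Rightarrow> complex) \<Rightarrow> bop set" where
  "ext_sum p \<phi>2 \<phi>3 = (\<lambda>f. calkin_pi p (op_dsum (rep (\<phi>2 f)) (rep (\<phi>3 f))))"

end

theory Submission
  imports Defs "HOL-Analysis.Analysis" "HOL-Library.Discrete_Functions"
begin

text \<open>
  The first extension is diagonal: \<open>f\<close> multiplies each coordinate by its value at a point of a dense
  sequence in the unit interval, each point being used infinitely often. The second one exploits
  the complemented Hilbertian subspaces of \<open>l\<^sup>p\<close>: on the dyadic block
  \<open>{2\<^sup>n..<2\<^sup>n\<^sup>+\<^sup>1}\<close> the function \<open>f\<close> multiplies the \<open>i\<close>-th Rademacher function by its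
  value at the \<open>i\<close>-th point, and Khintchine's inequality bounds this uniformly in \<open>n\<close>. An
  equivalence of the diagonal extension with the second one, or with a sum having it as a summand,
  yields an operator \<open>V\<close> that is bounded above and below and intertwines the two actions modulo
  compact operators. Compact operators tend to zero along disjointly supported unit vectors, so
  \<open>V\<close> maps \<open>N\<close> Rademacher functions of a late block to nearly disjointly supported vectors. The
  sum of \<open>N\<close> normalised Rademacher functions has norm of order \<open>N\<^sup>1\<^sup>/\<^sup>2\<close>, that of its image has
  order \<open>N\<^sup>1\<^sup>/\<^sup>p\<close>, and these orders differ because \<open>p \<noteq> 2\<close>.
\<close>

section \<open>Hoelder's and Minkowski's inequalities for finite sums\<close>

definition lpnorm_on :: "real \<Rightarrow> 'a set \<Rightarrow> ('a \<Rightarrow> 'b::real_normed_vector) \<Rightarrow> real" where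
  "lpnorm_on p A x = (\<Sum>i\<in>A. norm (x i) powr p) powr (1 / p)"

definition conjugate_exponents :: "real \<Rightarrow> real \<Rightarrow> bool" where
  "conjugate_exponents p q \<longleftrightarrow> 1 < p \<and> 1 < q \<and> 1 / p + 1 / q = 1"

lemma conjugate_exponents_divide: "1 < p \<Longrightarrow> conjugate_exponents p (p / (p - 1))"
  by (auto simp: conjugate_exponents_def field_simps)

lemma power_eq_conjugate_powr:
  fixes b :: real
  assumes "conjugate_exponents p q" "0 < b"
  shows "b ^ n = b powr (n / p) * b powr (n / q)"
proof -
  have "real n / p + real n / q = real n * (1 / p + 1 / q)"
    by (simp add: distrib_left)
  also have "\<dots> = n"
    using assms(1) by (simp add: conjugate_exponents_def)
  finally show ?thesis
    using assms(2) by (simp add: powr_realpow flip: powr_add)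
qed

lemma powr_le_powr_iff:
  fixes x y p :: real
  assumes "0 < p" "0 \<le> x" "0 \<le> y"
  shows "x powr p \<le> y powr p \<longleftrightarrow> x \<le> y"
  using assms powr_less_mono2[of p y x] powr_mono2[of p x y] by force

lemma lpnorm_on_nonneg [simp]: "0 \<le> lpnorm_on p A x"
  by (simp add: lpnorm_on_def)

lemma lpnorm_on_powr: "0 < p \<Longrightarrow> lpnorm_on p A x powr p = (\<Sum>i\<in>A. norm (x i) powr p)"
  by (simp add: lpnorm_on_def powr_powr sum_nonneg)

lemma lpnorm_on_cong: "(\<And>i. i \<in> A \<Longrightarrow> x i = y i) \<Longrightarrow> lpnorm_on p A x = lpnorm_on p A y"
  by (simp add: lpnorm_on_def)

lemma lpnorm_on_mono:
  assumes "0 < p" "\<And>i. i \<in> A \<Longrightarrow> norm (x i) \<le> norm (y i)"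
  shows "lpnorm_on p A x \<le> lpnorm_on p A y"
  unfolding lpnorm_on_def using assms by (intro powr_mono2 sum_mono sum_nonneg) auto

lemma lpnorm_on_scale:
  fixes x :: "'a \<Rightarrow> 'b::real_normed_div_algebra"
  assumes "0 < p"
  shows "lpnorm_on p A (\<lambda>i. c * x i) = norm c * lpnorm_on p A x"
  using assms
  by (simp add: lpnorm_on_def norm_mult powr_mult powr_powr sum_nonneg flip: sum_distrib_left)

lemma lpnorm_on_const: "0 < p \<Longrightarrow> lpnorm_on p A (\<lambda>i. c) = norm c * real (card A) powr (1 / p)"
  by (simp add: lpnorm_on_def powr_mult powr_powr)

lemma lpnorm_on_eq_0_iff: "finite A \<Longrightarrow> lpnorm_on p A x = 0 \<longleftrightarrow> (\<forall>i\<in>A. x i = 0)"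
  by (simp add: lpnorm_on_def sum_nonneg_eq_0_iff)

lemma Holder_sum:
  fixes x :: "'a \<Rightarrow> 'b::real_normed_vector" and y :: "'a \<Rightarrow> 'c::real_normed_vector"
  assumes exponents: "conjugate_exponents p q" and "finite A"
  shows "(\<Sum>i\<in>A. norm (x i) * norm (y i)) \<le> lpnorm_on p A x * lpnorm_on q A y"
proof (cases "lpnorm_on p A x = 0 \<or> lpnorm_on q A y = 0")
  case True
  then have "norm (x i) * norm (y i) = 0" if "i \<in> A" for i
    using that \<open>finite A\<close> by (auto simp: lpnorm_on_eq_0_iff)
  then have "(\<Sum>i\<in>A. norm (x i) * norm (y i)) = 0"
    by (rule sum.neutral[rule_format])
  then show ?thesis
    by simp
next
  case False
  define X where "X = lpnorm_on p A x"
  define Y where "Y = lpnorm_on q A y"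
  have pos: "0 < X" "0 < Y"
    using False by (auto simp: X_def Y_def less_le)
  have normalized: "(\<Sum>i\<in>A. (norm (z i) / Z) powr r) = 1"
    if "0 < r" "0 < Z" "Z = lpnorm_on r A z" for r Z and z :: "'a \<Rightarrow> 'd::real_normed_vector"
  proof -
    have "(\<Sum>i\<in>A. norm (z i) powr r) = Z powr r"
      using that by (simp add: lpnorm_on_powr)
    then show ?thesis
      using that(2) by (simp add: powr_divide less_imp_le flip: sum_divide_distrib)
  qed
  have "(\<Sum>i\<in>A. norm (x i) * norm (y i)) / (X * Y) = (\<Sum>i\<in>A. norm (x i) / X * (norm (y i) / Y))"
    by (simp add: sum_divide_distrib)
  also have "\<dots> \<le> (\<Sum>i\<in>A. (norm (x i) / X) powr p / p + (norm (y i) / Y) powr q / q)"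
    using exponents pos by (intro sum_mono Youngs_inequality) (auto simp: conjugate_exponents_def)
  also have "\<dots> = (\<Sum>i\<in>A. (norm (x i) / X) powr p) / p + (\<Sum>i\<in>A. (norm (y i) / Y) powr q) / q"
    by (simp add: sum.distrib sum_divide_distrib)
  also have "\<dots> = 1"
    using exponents normalized[OF _ pos(1) X_def] normalized[OF _ pos(2) Y_def]
    by (simp add: conjugate_exponents_def)
  finally show ?thesis
    using pos by (simp add: X_def Y_def field_simps)
qed

lemma Minkowski_sum:
  fixes x y :: "'a \<Rightarrow> 'b::real_normed_vector"
  assumes "1 < p" "finite A"
  shows "lpnorm_on p A (\<lambda>i. x i + y i) \<le> lpnorm_on p A x + lpnorm_on p A y"
proof (cases "lpnorm_on p A (\<lambda>i. x i + y i) = 0")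
  case False
  define q where "q = p / (p - 1)"
  have exponents: "conjugate_exponents p q"
    unfolding q_def by (rule conjugate_exponents_divide[OF assms(1)])
  have q_cancel: "(p - 1) * q = p" and p_div_q: "p / q = p - 1"
    using assms(1) by (auto simp: q_def)
  define S where "S = lpnorm_on p A (\<lambda>i. x i + y i)"
  define w where "w i = norm (x i + y i) powr (p - 1)" for i
  have S_pos: "0 < S" and S_powr: "S powr p = (\<Sum>i\<in>A. norm (x i + y i) powr p)"
    using False assms(1) by (auto simp: S_def less_le lpnorm_on_powr)
  have norm_w: "lpnorm_on q A w = S powr (p - 1)"
    using S_pos q_cancel p_div_q by (simp add: lpnorm_on_def w_def powr_powr flip: S_powr)
  have "S * S powr (p - 1) = (\<Sum>i\<in>A. norm (x i + y i) * w i)"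
    using S_pos S_powr by (simp add: w_def powr_mult_base)
  also have "\<dots> \<le> (\<Sum>i\<in>A. norm (x i) * norm (w i) + norm (y i) * norm (w i))"
    unfolding distrib_right[symmetric]
    by (intro sum_mono mult_mono norm_triangle_ineq) (auto simp: w_def)
  also have "\<dots> \<le> (lpnorm_on p A x + lpnorm_on p A y) * S powr (p - 1)"
    using Holder_sum[OF exponents assms(2), of x w] Holder_sum[OF exponents assms(2), of y w]
    by (simp add: norm_w sum.distrib distrib_right)
  finally show ?thesis
    using S_pos by (simp add: S_def)
qed (simp add: add_nonneg_nonneg)

section \<open>Rademacher functions and Khintchine's inequality\<close>

definition block :: "nat \<Rightarrow> nat set" where
  "block n = {2 ^ n..<2 ^ Suc n}"

definition rademacher :: "nat \<Rightarrow> nat \<Rightarrow> real" where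
  "rademacher i m = (if bit m i then -1 else 1)"

definition rademacher_sum :: "nat \<Rightarrow> (nat \<Rightarrow> complex) \<Rightarrow> seq" where
  "rademacher_sum n a = (\<lambda>m. \<Sum>i<n. a i * rademacher i m)"

definition rademacher_coeff :: "nat \<Rightarrow> seq \<Rightarrow> nat \<Rightarrow> complex" where
  "rademacher_coeff n x i = (\<Sum>m\<in>block n. x m * rademacher i m) / 2 ^ n"

definition khintchine_const :: "real \<Rightarrow> real" where
  "khintchine_const s = s * (2 * exp 2) powr (1 / s)"

lemma finite_block [simp]: "finite (block n)"
  by (simp add: block_def)

lemma card_block [simp]: "card (block n) = 2 ^ n"
  by (simp add: block_def)

lemma floor_log_block: "m \<in> block n \<Longrightarrow> floor_log m = n"
  by (auto simp: block_def intro: floor_log_eqI)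

lemma mem_block_floor_log: "0 < m \<Longrightarrow> m \<in> block (floor_log m)"
  using floor_log_exp2_le floor_log_exp2_gt by (simp add: block_def)

lemma lessThan_power2_Suc: "{..<(2::nat) ^ Suc n} = {..<2 ^ n} \<union> block n"
  unfolding block_def by (rule ivl_disj_un_one(2)[symmetric]) simp

lemma sum_prod_bits:
  fixes g :: "nat \<Rightarrow> bool \<Rightarrow> 'a :: comm_semiring_1"
  shows "(\<Sum>k<(2::nat) ^ n. \<Prod>i<n. g i (bit k i)) = (\<Prod>i<n. g i False + g i True)"
proof (induction n arbitrary: g)
  case (Suc n)
  have "(\<Sum>k<(2::nat) ^ Suc n. \<Prod>i<Suc n. g i (bit k i)) =
      (\<Sum>m<(2::nat) ^ n. \<Sum>k\<in>{m * 2..<m * 2 + 2}. \<Prod>i<Suc n. g i (bit k i))"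
    by (subst sum.nat_group) (simp add: mult.commute)
  also have "\<dots> = (\<Sum>m<(2::nat) ^ n. (g 0 False + g 0 True) * (\<Prod>i<n. g (Suc i) (bit m i)))"
  proof (rule sum.cong[OF refl])
    fix m :: nat
    have "{m * 2..<m * 2 + 2} = {m * 2, Suc (m * 2)}"
      by auto
    then show "(\<Sum>k\<in>{m * 2..<m * 2 + 2}. \<Prod>i<Suc n. g i (bit k i)) =
        (g 0 False + g 0 True) * (\<Prod>i<n. g (Suc i) (bit m i))"
      by (simp add: prod.lessThan_Suc_shift bit_Suc bit_0 distrib_right del: prod.lessThan_Suc)
  qed
  also have "\<dots> = (g 0 False + g 0 True) * (\<Prod>i<n. g (Suc i) False + g (Suc i) True)"
    by (simp add: Suc.IH[of "\<lambda>i. g (Suc i)"] flip: sum_distrib_left)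
  finally show ?case
    by (simp add: prod.lessThan_Suc_shift del: prod.lessThan_Suc)
qed simp

lemma bit_power2_add:
  assumes "i < n"
  shows "bit (2 ^ n + k :: nat) i = bit k i"
proof -
  have "take_bit n (2 ^ n + k) = take_bit n k"
    by (simp add: take_bit_eq_mod)
  then show ?thesis
    using assms by (metis bit_take_bit_iff)
qed

lemma sum_block_prod_bits:
  fixes g :: "nat \<Rightarrow> bool \<Rightarrow> 'a :: comm_semiring_1"
  shows "(\<Sum>m\<in>block n. \<Prod>i<n. g i (bit m i)) = (\<Prod>i<n. g i False + g i True)"
proof -
  have "(\<Sum>m\<in>block n. \<Prod>i<n. g i (bit m i)) = (\<Sum>k<(2::nat) ^ n. \<Prod>i<n. g i (bit (2 ^ n + k) i))"
    unfolding block_def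
    by (rule sum.reindex_bij_witness[where i = "\<lambda>k. 2 ^ n + k" and j = "\<lambda>m. m - 2 ^ n"]) auto
  then show ?thesis
    by (simp add: bit_power2_add sum_prod_bits)
qed

lemma sum_block_rademacher_mult:
  assumes "i < n" "j < n"
  shows "(\<Sum>m\<in>block n. rademacher i m * rademacher j m) = (if i = j then 2 ^ n else 0)"
proof (cases "i = j")
  case True
  then show ?thesis
    by (simp add: rademacher_def if_distrib cong: if_cong)
next
  case False
  define g :: "nat \<Rightarrow> bool \<Rightarrow> real" where "g l b = (if (l = i \<or> l = j) \<and> b then -1 else 1)" for l b
  have "rademacher i m * rademacher j m = (\<Prod>l<n. g l (bit m l))" for m
  proof -
    have "(\<Prod>l<n. g l (bit m l)) = (\<Prod>l\<in>{i, j}. g l (bit m l))"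
      by (rule prod.mono_neutral_right) (use assms in \<open>auto simp: g_def\<close>)
    then show ?thesis
      using False by (simp add: g_def rademacher_def)
  qed
  then have "(\<Sum>m\<in>block n. rademacher i m * rademacher j m) = (\<Prod>l<n. g l False + g l True)"
    by (simp add: sum_block_prod_bits)
  also have "\<dots> = 0"
    by (rule prod_zero) (use assms in \<open>auto simp: g_def\<close>)
  finally show ?thesis
    using False by simp
qed

lemma rademacher_coeff_cong:
  "(\<And>m. m \<in> block n \<Longrightarrow> x m = y m) \<Longrightarrow> rademacher_coeff n x i = rademacher_coeff n y i"
  by (simp add: rademacher_coeff_def)

lemma rademacher_coeff_rademacher_sum:
  assumes "i < n"
  shows "rademacher_coeff n (rademacher_sum n a) i = a i"
proof -
  have "(\<Sum>m\<in>block n. rademacher_sum n a m * rademacher i m) =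
      (\<Sum>m\<in>block n. \<Sum>j<n. a j * complex_of_real (rademacher j m * rademacher i m))"
    by (simp add: rademacher_sum_def sum_distrib_right mult.assoc)
  also have "\<dots> = (\<Sum>j<n. a j * complex_of_real (\<Sum>m\<in>block n. rademacher j m * rademacher i m))"
    by (subst sum.swap) (simp add: sum_distrib_left)
  also have "\<dots> = (\<Sum>j<n. if j = i then a j * 2 ^ n else 0)"
    using assms by (intro sum.cong) (auto simp: sum_block_rademacher_mult simp del: of_real_sum)
  finally show ?thesis
    using assms by (simp add: rademacher_coeff_def)
qed

lemma power2_mult_fact_le: "2 ^ n * fact n \<le> (fact (2 * n) :: real)"
proof (induction n)
  case (Suc n)
  have "2 ^ Suc n * fact (Suc n) = (2 * real n + 2) * (2 ^ n * fact n)"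
    by (simp add: algebra_simps)
  also have "\<dots> \<le> (2 * real n + 2) * ((2 * real n + 1) * fact (2 * n))"
    by (intro mult_left_mono order_trans[OF Suc.IH]) auto
  finally show ?case
    by (simp add: algebra_simps)
qed simp

lemma cosh_le_exp_half_square:
  fixes a :: real
  shows "cosh a \<le> exp (a\<^sup>2 / 2)"
proof -
  have "(\<lambda>n. a ^ (2 * n) / fact (2 * n)) sums cosh a"
  proof -
    have "(\<lambda>n. if even (2 * n) then a ^ (2 * n) /\<^sub>R fact (2 * n) else 0) sums cosh a"
      by (subst sums_mono_reindex[of "\<lambda>n. 2 * n" "\<lambda>n. if even n then a ^ n /\<^sub>R fact n else 0"])
        (auto simp: strict_mono_def cosh_converges elim: evenE)
    then show ?thesis
      by (simp add: divide_inverse mult.commute)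
  qed
  moreover have "(\<lambda>n. (a\<^sup>2 / 2) ^ n / fact n) sums exp (a\<^sup>2 / 2)"
    using exp_converges[of "a\<^sup>2 / 2"] by (simp only: real_scaleR_def divide_inverse mult.commute)
  moreover have "a ^ (2 * n) / fact (2 * n) \<le> (a\<^sup>2 / 2) ^ n / fact n" for n
  proof -
    have "a ^ (2 * n) / fact (2 * n) \<le> a ^ (2 * n) / (2 ^ n * fact n)"
      using power2_mult_fact_le[of n] by (intro divide_left_mono) auto
    then show ?thesis
      by (simp add: power_mult power_divide)
  qed
  ultimately show ?thesis
    by (rule sums_le[rotated])
qed

lemma sum_block_exp_rademacher_le:
  fixes a :: "nat \<Rightarrow> real"
  shows "(\<Sum>m\<in>block n. exp (\<Sum>i<n. a i * rademacher i m)) \<le> 2 ^ n * exp ((\<Sum>i<n. (a i)\<^sup>2) / 2)"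
proof -
  have "(\<Sum>m\<in>block n. exp (\<Sum>i<n. a i * rademacher i m)) =
      (\<Sum>m\<in>block n. \<Prod>i<n. (\<lambda>i b. exp (a i * (if b then -1 else 1))) i (bit m i))"
    by (simp add: exp_sum rademacher_def)
  also have "\<dots> = (\<Prod>i<n. exp (a i) + exp (- a i))"
    by (subst sum_block_prod_bits) simp
  also have "\<dots> = (\<Prod>i<n. 2 * cosh (a i))"
    by (rule prod.cong) (simp_all add: cosh_field_def)
  also have "\<dots> \<le> (\<Prod>i<n. 2 * exp ((a i)\<^sup>2 / 2))"
    by (intro prod_mono) (auto simp: cosh_le_exp_half_square)
  finally show ?thesis
    by (simp add: prod.distrib exp_sum sum_divide_distrib)
qed

lemma exp_add_abs_le:
  fixes u v :: real
  shows "exp (\<bar>u\<bar> + \<bar>v\<bar>) \<le> (exp (2 * u) + exp (2 * - u) + exp (2 * v) + exp (2 * - v)) / 2"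
proof -
  have "2 * exp (\<bar>u\<bar> + \<bar>v\<bar>) \<le> exp (2 * \<bar>u\<bar>) + exp (2 * \<bar>v\<bar>)"
    using sum_squares_bound[of "exp \<bar>u\<bar>" "exp \<bar>v\<bar>"]
    by (simp add: exp_add exp_double power2_eq_square)
  moreover have "exp (2 * \<bar>w\<bar>) \<le> exp (2 * w) + exp (2 * - w)" for w :: real
    by (cases "0 \<le> w") auto
  ultimately show ?thesis
    unfolding le_divide_eq_numeral1 by (smt (verit) mult.commute)
qed

lemma sum_block_exp_norm_rademacher_sum_le:
  "(\<Sum>m\<in>block n. exp (cmod (rademacher_sum n a m))) \<le> 2 * 2 ^ n * exp (2 * (\<Sum>i<n. (cmod (a i))\<^sup>2))"
proof -
  define B where "B = 2 ^ n * exp (2 * (\<Sum>i<n. (cmod (a i))\<^sup>2))"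
  have real_part: "(\<Sum>m\<in>block n. exp (2 * (\<Sum>i<n. b i * rademacher i m))) \<le> B"
    if "\<And>i. \<bar>b i\<bar> \<le> cmod (a i)" for b
  proof -
    have "(\<Sum>m\<in>block n. exp (2 * (\<Sum>i<n. b i * rademacher i m))) \<le> 2 ^ n * exp (2 * (\<Sum>i<n. (b i)\<^sup>2))"
      using sum_block_exp_rademacher_le[of "\<lambda>i. 2 * b i" n]
      by (simp add: sum_distrib_left power_mult_distrib mult_ac sum_divide_distrib)
    also have "\<dots> \<le> B"
      unfolding B_def using that power_mono[OF that abs_ge_zero, of _ 2] by (simp add: sum_mono)
    finally show ?thesis .
  qed
  define U where "U m = (\<Sum>i<n. Re (a i) * rademacher i m)" for m
  define V where "V m = (\<Sum>i<n. Im (a i) * rademacher i m)" for m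
  have "exp (cmod (rademacher_sum n a m)) \<le> exp (\<bar>U m\<bar> + \<bar>V m\<bar>)" for m
    using cmod_le[of "rademacher_sum n a m"] by (simp add: rademacher_sum_def U_def V_def)
  then have "(\<Sum>m\<in>block n. exp (cmod (rademacher_sum n a m))) \<le>
      (\<Sum>m\<in>block n. (exp (2 * U m) + exp (2 * - U m) + exp (2 * V m) + exp (2 * - V m)) / 2)"
    by (intro sum_mono order_trans[OF _ exp_add_abs_le])
  also have "\<dots> = ((\<Sum>m\<in>block n. exp (2 * U m)) + (\<Sum>m\<in>block n. exp (2 * - U m)) +
      (\<Sum>m\<in>block n. exp (2 * V m)) + (\<Sum>m\<in>block n. exp (2 * - V m))) / 2"
    by (simp add: sum.distrib flip: sum_divide_distrib)
  also have "\<dots> \<le> (B + B + B + B) / 2"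
    using real_part[of "\<lambda>i. Re (a i)"] real_part[of "\<lambda>i. - Re (a i)"]
      real_part[of "\<lambda>i. Im (a i)"] real_part[of "\<lambda>i. - Im (a i)"]
    by (intro divide_right_mono add_mono)
      (auto simp: U_def V_def abs_Re_le_cmod abs_Im_le_cmod sum_negf)
  finally show ?thesis
    by (simp add: B_def)
qed

lemma powr_le_exp:
  fixes s t :: real
  assumes "0 < s" "0 \<le> t"
  shows "t powr s \<le> s powr s * exp t"
proof -
  have "t / s \<le> exp (t / s)"
    using exp_ge_add_one_self[of "t / s"] by linarith
  then have "(t / s) powr s \<le> exp (t / s) powr s"
    using assms by (intro powr_mono2) auto
  then show ?thesis
    using assms by (simp add: powr_divide exp_powr_real field_simps)
qed

lemma khintchine_const_pos: "0 < s \<Longrightarrow> 0 < khintchine_const s"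
  by (simp add: khintchine_const_def)

lemma khintchine:
  assumes "0 < s"
  shows "lpnorm_on s (block n) (rademacher_sum n a) \<le>
    khintchine_const s * 2 powr (n / s) * lpnorm_on 2 {..<n} a"
proof (cases "lpnorm_on 2 {..<n} a = 0")
  case True
  then show ?thesis
    using assms
    by (simp add: lpnorm_on_eq_0_iff rademacher_sum_def lpnorm_on_const khintchine_const_def)
next
  case False
  define L where "L = lpnorm_on 2 {..<n} a"
  define b where "b = (\<lambda>i. inverse L * a i)"
  have L_pos: "0 < L"
    using False by (simp add: L_def less_le)
  have "lpnorm_on 2 {..<n} b = 1"
    using L_pos by (simp add: b_def lpnorm_on_scale norm_inverse flip: L_def)
  then have sum_b: "(\<Sum>i<n. (cmod (b i))\<^sup>2) = 1"
    using lpnorm_on_powr[of 2 "{..<n}" b] by simp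
  have "(\<Sum>m\<in>block n. cmod (rademacher_sum n b m) powr s) \<le>
      (\<Sum>m\<in>block n. s powr s * exp (cmod (rademacher_sum n b m)))"
    using assms by (intro sum_mono powr_le_exp) auto
  also have "\<dots> \<le> s powr s * (2 * 2 ^ n * exp 2)"
    unfolding sum_distrib_left[symmetric]
    using sum_block_exp_norm_rademacher_sum_le[of n b] sum_b by (intro mult_left_mono) auto
  finally have "lpnorm_on s (block n) (rademacher_sum n b) \<le>
      (s powr s * (2 * 2 ^ n * exp 2)) powr (1 / s)"
    unfolding lpnorm_on_def using assms by (intro powr_mono2) (auto simp: sum_nonneg)
  also have "\<dots> = khintchine_const s * 2 powr (n / s)"
    using assms by (simp add: khintchine_const_def powr_mult powr_powr flip: powr_realpow)
  finally have "L * lpnorm_on s (block n) (rademacher_sum n b) \<le>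
      L * (khintchine_const s * 2 powr (n / s))"
    using L_pos by (intro mult_left_mono) auto
  moreover have "rademacher_sum n a = (\<lambda>m. L * rademacher_sum n b m)"
    using L_pos by (simp add: rademacher_sum_def b_def sum_distrib_left flip: mult.assoc)
  ultimately show ?thesis
    using assms L_pos by (simp add: lpnorm_on_scale mult_ac flip: L_def)
qed

lemma sum_mult_rademacher_coeff:
  "(\<Sum>i<n. a i * rademacher_coeff n x i) = (\<Sum>m\<in>block n. x m * rademacher_sum n a m) / 2 ^ n"
proof -
  have "(\<Sum>i<n. a i * rademacher_coeff n x i) =
      (\<Sum>i<n. \<Sum>m\<in>block n. x m * (a i * rademacher i m)) / 2 ^ n"
    by (simp add: rademacher_coeff_def sum_distrib_left sum_divide_distrib mult_ac)
  also have "\<dots> = (\<Sum>m\<in>block n. x m * rademacher_sum n a m) / 2 ^ n"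
    by (subst sum.swap) (simp add: rademacher_sum_def sum_distrib_left)
  finally show ?thesis .
qed

lemma lpnorm_on_rademacher_coeff_le:
  assumes exponents: "conjugate_exponents p q"
  shows "lpnorm_on 2 {..<n} (rademacher_coeff n x) \<le>
    khintchine_const q / 2 powr (n / p) * lpnorm_on p (block n) x"
proof (cases "lpnorm_on 2 {..<n} (rademacher_coeff n x) = 0")
  case True
  then show ?thesis
    using exponents khintchine_const_pos[of q] by (simp add: conjugate_exponents_def)
next
  case False
  define L where "L = lpnorm_on 2 {..<n} (rademacher_coeff n x)"
  define a where "a = (\<lambda>i. cnj (rademacher_coeff n x i))"
  have L_pos: "0 < L" and L_square: "L\<^sup>2 = (\<Sum>i<n. (cmod (rademacher_coeff n x i))\<^sup>2)"
    using False lpnorm_on_powr[of 2 "{..<n}" "rademacher_coeff n x"] by (auto simp: L_def less_le)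
  have "complex_of_real (L\<^sup>2) = (\<Sum>i<n. a i * rademacher_coeff n x i)"
    unfolding L_square a_def of_real_sum complex_norm_square by (simp add: mult.commute)
  then have "L\<^sup>2 = cmod ((\<Sum>m\<in>block n. x m * rademacher_sum n a m) / 2 ^ n)"
    unfolding sum_mult_rademacher_coeff by (metis abs_of_nonneg norm_of_real zero_le_power2)
  also have "\<dots> = cmod (\<Sum>m\<in>block n. x m * rademacher_sum n a m) / 2 ^ n"
    by (simp add: norm_divide norm_power)
  also have "\<dots> \<le> (\<Sum>m\<in>block n. cmod (x m) * cmod (rademacher_sum n a m)) / 2 ^ n"
    by (intro divide_right_mono sum_norm_le) (auto simp: norm_mult)
  also have "\<dots> \<le> lpnorm_on p (block n) x * lpnorm_on q (block n) (rademacher_sum n a) / 2 ^ n"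
    by (intro divide_right_mono Holder_sum exponents) auto
  also have "\<dots> \<le> lpnorm_on p (block n) x * (khintchine_const q * 2 powr (n / q) * L) / 2 ^ n"
    using khintchine[of q n a] exponents
    by (intro divide_right_mono mult_left_mono)
      (auto simp: conjugate_exponents_def L_def a_def lpnorm_on_def)
  finally have "L * L \<le> khintchine_const q / 2 powr (n / p) * lpnorm_on p (block n) x * L"
    by (simp add: power_eq_conjugate_powr[OF exponents] power2_eq_square mult_ac)
  then show ?thesis
    unfolding L_def[symmetric] by (rule mult_right_le_imp_le) (rule L_pos)
qed

lemma lpnorm_on_rademacher_sum_ge:
  assumes "conjugate_exponents p q"
  shows "2 powr (n / p) * lpnorm_on 2 {..<n} a \<le>
    khintchine_const q * lpnorm_on p (block n) (rademacher_sum n a)"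
proof -
  have "lpnorm_on 2 {..<n} a = lpnorm_on 2 {..<n} (rademacher_coeff n (rademacher_sum n a))"
    by (intro lpnorm_on_cong) (simp add: rademacher_coeff_rademacher_sum)
  also have "\<dots> \<le> khintchine_const q / 2 powr (n / p) * lpnorm_on p (block n) (rademacher_sum n a)"
    by (rule lpnorm_on_rademacher_coeff_le[OF assms])
  finally show ?thesis
    by (simp add: field_simps)
qed

lemma lpnorm_on_rademacher_multiplier_le:
  assumes exponents: "conjugate_exponents p q" and coeff_bound: "\<And>i. cmod (c i) \<le> B"
  shows "lpnorm_on p (block n) (rademacher_sum n (\<lambda>i. c i * rademacher_coeff n x i)) \<le>
    khintchine_const p * khintchine_const q * B * lpnorm_on p (block n) x"
proof -
  have B_nonneg: "0 \<le> B"
    using coeff_bound[of 0] norm_ge_zero[of "c 0"] by linarith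
  have "lpnorm_on 2 {..<n} (\<lambda>i. c i * rademacher_coeff n x i) \<le>
      lpnorm_on 2 {..<n} (\<lambda>i. of_real B * rademacher_coeff n x i)"
    using coeff_bound B_nonneg by (intro lpnorm_on_mono) (auto simp: norm_mult mult_right_mono)
  also have "\<dots> = B * lpnorm_on 2 {..<n} (rademacher_coeff n x)"
    using B_nonneg by (simp add: lpnorm_on_scale)
  also have "\<dots> \<le> B * (khintchine_const q / 2 powr (n / p) * lpnorm_on p (block n) x)"
    using B_nonneg by (intro mult_left_mono lpnorm_on_rademacher_coeff_le exponents)
  finally have coeffs: "lpnorm_on 2 {..<n} (\<lambda>i. c i * rademacher_coeff n x i) \<le> \<dots>" .
  have "lpnorm_on p (block n) (rademacher_sum n (\<lambda>i. c i * rademacher_coeff n x i)) \<le>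
      khintchine_const p * 2 powr (n / p) * lpnorm_on 2 {..<n} (\<lambda>i. c i * rademacher_coeff n x i)"
    using exponents by (intro khintchine) (simp add: conjugate_exponents_def)
  also have "\<dots> \<le> khintchine_const p * 2 powr (n / p) *
      (B * (khintchine_const q / 2 powr (n / p) * lpnorm_on p (block n) x))"
    using exponents khintchine_const_pos[of p]
    by (intro mult_left_mono coeffs) (auto simp: conjugate_exponents_def)
  finally show ?thesis
    by (simp add: mult_ac)
qed

section \<open>The space \<open>l\<^sup>p\<close>\<close>

definition seq_sum :: "('i \<Rightarrow> seq) \<Rightarrow> 'i set \<Rightarrow> seq" where
  "seq_sum x F = (\<lambda>k. \<Sum>i\<in>F. x i k)"

definition seq_supp :: "seq \<Rightarrow> nat set" where
  "seq_supp x = {k. x k \<noteq> 0}"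

definition lp_tendsto :: "real \<Rightarrow> (nat \<Rightarrow> seq) \<Rightarrow> seq \<Rightarrow> bool" where
  "lp_tendsto p x y \<longleftrightarrow> y \<in> lp p \<and> (\<lambda>n. lpnorm p (seq_diff (x n) y)) \<longlonglongrightarrow> 0"

lemmas seq_ops_defs = seq_add_def seq_scale_def seq_diff_def

lemma seq_diff_conv_add: "seq_diff x y = seq_add x (seq_scale (-1) y)"
  by (simp add: seq_ops_defs)

lemma seq_sum_insert:
  "finite F \<Longrightarrow> i \<notin> F \<Longrightarrow> seq_sum x (insert i F) = seq_add (x i) (seq_sum x F)"
  by (simp add: seq_sum_def seq_add_def)

lemma seq_sum_empty [simp]: "seq_sum x {} = (\<lambda>k. 0)"
  by (simp add: seq_sum_def)

lemma lpnorm_nonneg [simp]: "0 \<le> lpnorm p x"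
  by (simp add: lpnorm_def)

lemma lpnorm_zero [simp]: "lpnorm p (\<lambda>k. 0) = 0"
  by (simp add: lpnorm_def)

lemma lp_zero [simp]: "(\<lambda>k. 0) \<in> lp p"
  by (simp add: lp_def)

locale lp_space =
  fixes p :: real
  assumes p_gt_1: "1 < p"
begin

lemma p_pos: "0 < p"
  using p_gt_1 by simp

lemma lpnorm_powr: "x \<in> lp p \<Longrightarrow> lpnorm p x powr p = (\<Sum>k. cmod (x k) powr p)"
  using p_pos by (simp add: lpnorm_def lp_def powr_powr suminf_nonneg)

lemma lpnorm_on_le_lpnorm:
  assumes "x \<in> lp p" "finite A"
  shows "lpnorm_on p A x \<le> lpnorm p x"
proof -
  have "lpnorm_on p A x powr p \<le> lpnorm p x powr p"
    unfolding lpnorm_on_powr[OF p_pos] lpnorm_powr[OF assms(1)]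
    using assms by (intro sum_le_suminf) (auto simp: lp_def)
  then show ?thesis
    by (simp add: powr_le_powr_iff p_pos)
qed

lemma lp_of_partial_sums:
  assumes "\<And>N. lpnorm_on p {..<N} x \<le> B"
  shows "x \<in> lp p" "lpnorm p x \<le> B"
proof -
  have B_nonneg: "0 \<le> B"
    using order_trans[OF lpnorm_on_nonneg assms] .
  have partial: "(\<Sum>k<N. cmod (x k) powr p) \<le> B powr p" for N
    using assms[of N] B_nonneg powr_mono2[of p "lpnorm_on p {..<N} x" B]
      lpnorm_on_powr[OF p_pos, of "{..<N}" x] p_pos
    by simp
  then have summable: "summable (\<lambda>k. cmod (x k) powr p)"
    by (intro summableI_nonneg_bounded) auto
  then show "x \<in> lp p"
    by (simp add: lp_def)
  then have "lpnorm p x powr p \<le> B powr p"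
    using suminf_le_const[OF summable partial] by (simp add: lpnorm_powr)
  then show "lpnorm p x \<le> B"
    using B_nonneg by (simp add: powr_le_powr_iff p_pos)
qed

lemma lp_finite_support:
  assumes "finite A" "seq_supp x \<subseteq> A"
  shows "x \<in> lp p" "lpnorm p x = lpnorm_on p A x"
proof -
  have "(\<lambda>k. cmod (x k) powr p) sums (\<Sum>k\<in>A. cmod (x k) powr p)"
    by (rule sums_finite) (use assms in \<open>auto simp: seq_supp_def\<close>)
  then show "x \<in> lp p" "lpnorm p x = lpnorm_on p A x"
    by (auto simp: lp_def sums_iff lpnorm_def lpnorm_on_def)
qed

lemma cmod_le_lpnorm: "x \<in> lp p \<Longrightarrow> cmod (x k) \<le> lpnorm p x"
  using lpnorm_on_le_lpnorm[of x "{k}"] p_pos by (simp add: lpnorm_on_def powr_powr)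

lemma seq_add_partial_sums:
  assumes "x \<in> lp p" "y \<in> lp p"
  shows "lpnorm_on p {..<N} (seq_add x y) \<le> lpnorm p x + lpnorm p y"
  unfolding seq_add_def
  by (intro order_trans[OF Minkowski_sum add_mono] lpnorm_on_le_lpnorm assms p_gt_1 finite_lessThan)

lemma lp_add: "x \<in> lp p \<Longrightarrow> y \<in> lp p \<Longrightarrow> seq_add x y \<in> lp p"
  by (rule lp_of_partial_sums(1)[OF seq_add_partial_sums])

lemma lpnorm_add_le: "x \<in> lp p \<Longrightarrow> y \<in> lp p \<Longrightarrow> lpnorm p (seq_add x y) \<le> lpnorm p x + lpnorm p y"
  by (rule lp_of_partial_sums(2)[OF seq_add_partial_sums])

lemma lp_scale: "x \<in> lp p \<Longrightarrow> seq_scale c x \<in> lp p"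
  by (simp add: lp_def seq_scale_def norm_mult powr_mult summable_mult)

lemma lpnorm_scale: "x \<in> lp p \<Longrightarrow> lpnorm p (seq_scale c x) = cmod c * lpnorm p x"
  using p_pos
  by (simp add: lp_def lpnorm_def seq_scale_def norm_mult powr_mult suminf_mult suminf_nonneg
      powr_powr)

lemma lp_diff: "x \<in> lp p \<Longrightarrow> y \<in> lp p \<Longrightarrow> seq_diff x y \<in> lp p"
  by (simp add: seq_diff_conv_add lp_add lp_scale)

lemma lpnorm_diff_commute:
  assumes "x \<in> lp p" "y \<in> lp p"
  shows "lpnorm p (seq_diff x y) = lpnorm p (seq_diff y x)"
proof -
  have "seq_diff x y = seq_scale (-1) (seq_diff y x)"
    by (simp add: seq_ops_defs)
  then show ?thesis
    using assms by (simp add: lpnorm_scale lp_diff)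
qed

lemma lpnorm_le_add_diff:
  assumes "x \<in> lp p" "y \<in> lp p"
  shows "lpnorm p x \<le> lpnorm p y + lpnorm p (seq_diff x y)"
proof -
  have "x = seq_add y (seq_diff x y)"
    by (simp add: seq_ops_defs)
  then show ?thesis
    using lpnorm_add_le[OF assms(2) lp_diff[OF assms]] by simp
qed

lemma lp_seq_sum:
  assumes "finite F" "\<And>i. i \<in> F \<Longrightarrow> x i \<in> lp p"
  shows "seq_sum x F \<in> lp p"
  using assms by (induction F rule: finite_induct) (auto simp: seq_sum_insert lp_add)

lemma lpnorm_seq_sum_le:
  assumes "finite F" "\<And>i. i \<in> F \<Longrightarrow> x i \<in> lp p"
  shows "lpnorm p (seq_sum x F) \<le> (\<Sum>i\<in>F. lpnorm p (x i))"
  using assms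
proof (induction F rule: finite_induct)
  case (insert i F)
  then show ?case
    using lpnorm_add_le[of "x i" "seq_sum x F"] lp_seq_sum[of F x] by (simp add: seq_sum_insert)
qed simp

lemma lpnorm_seq_sum_disjoint:
  assumes "finite F" "\<And>i. i \<in> F \<Longrightarrow> x i \<in> lp p"
    and disj: "disjoint_family_on (\<lambda>i. seq_supp (x i)) F"
  shows "lpnorm p (seq_sum x F) = lpnorm_on p F (\<lambda>i. lpnorm p (x i))"
proof -
  have "cmod (seq_sum x F k) powr p = (\<Sum>i\<in>F. cmod (x i k) powr p)" for k
  proof (cases "\<exists>i\<in>F. x i k \<noteq> 0")
    case True
    then obtain i where i_mem: "i \<in> F" and nonzero: "x i k \<noteq> 0"
      by blast
    then have "x j k = 0" if "j \<in> F - {i}" for j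
      using disj that unfolding disjoint_family_on_def seq_supp_def by blast
    then show ?thesis
      using assms(1) i_mem nonzero by (simp add: seq_sum_def sum.remove)
  qed (simp add: seq_sum_def)
  then have "lpnorm p (seq_sum x F) powr p = (\<Sum>k. \<Sum>i\<in>F. cmod (x i k) powr p)"
    using lp_seq_sum[of F x] assms(1,2) by (simp add: lpnorm_powr)
  also have "\<dots> = (\<Sum>i\<in>F. \<Sum>k. cmod (x i k) powr p)"
    using assms(2) by (intro suminf_sum) (simp add: lp_def)
  also have "\<dots> = lpnorm_on p F (\<lambda>i. lpnorm p (x i)) powr p"
    using assms(2) by (simp add: lpnorm_powr lpnorm_on_powr p_pos)
  finally show ?thesis
    by (simp add: powr_le_powr_iff p_pos order_eq_iff)
qed

lemma lpnorm_seq_sum_disjoint_ge: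
  assumes "finite F" "\<And>i. i \<in> F \<Longrightarrow> x i \<in> lp p" "disjoint_family_on (\<lambda>i. seq_supp (x i)) F"
    and "0 \<le> a" "\<And>i. i \<in> F \<Longrightarrow> a \<le> lpnorm p (x i)"
  shows "a * card F powr (1 / p) \<le> lpnorm p (seq_sum x F)"
  using assms lpnorm_on_mono[OF p_pos, of F "\<lambda>i. a" "\<lambda>i. lpnorm p (x i)"]
  by (simp add: lpnorm_seq_sum_disjoint lpnorm_on_const p_pos)

lemma lpnorm_seq_sum_disjoint_le:
  assumes "finite F" "\<And>i. i \<in> F \<Longrightarrow> x i \<in> lp p" "disjoint_family_on (\<lambda>i. seq_supp (x i)) F"
    and "0 \<le> b" "\<And>i. i \<in> F \<Longrightarrow> lpnorm p (x i) \<le> b"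
  shows "lpnorm p (seq_sum x F) \<le> b * card F powr (1 / p)"
  using assms lpnorm_on_mono[OF p_pos, of F "\<lambda>i. lpnorm p (x i)" "\<lambda>i. b"]
  by (simp add: lpnorm_seq_sum_disjoint lpnorm_on_const p_pos)

lemma lp_tendsto_compose:
  assumes "lp_tendsto p x y" "z \<in> lp p"
    and "\<And>n. lpnorm p (seq_diff (w n) z) \<le> B * lpnorm p (seq_diff (x n) y)"
  shows "lp_tendsto p w z"
proof -
  have "(\<lambda>n. B * lpnorm p (seq_diff (x n) y)) \<longlonglongrightarrow> 0"
    using assms(1) by (intro tendsto_mult_right_zero) (simp add: lp_tendsto_def)
  then have "(\<lambda>n. lpnorm p (seq_diff (w n) z)) \<longlonglongrightarrow> 0"
    by (rule Lim_null_comparison[rotated]) (simp add: assms(3))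
  then show ?thesis
    using assms(2) by (simp add: lp_tendsto_def)
qed

lemma lp_tendsto_add:
  assumes "\<And>n. x n \<in> lp p" "\<And>n. w n \<in> lp p" "lp_tendsto p x y" "lp_tendsto p w z"
  shows "lp_tendsto p (\<lambda>n. seq_add (x n) (w n)) (seq_add y z)"
proof -
  have limits_lp: "y \<in> lp p" "z \<in> lp p"
    using assms(3,4) by (auto simp: lp_tendsto_def)
  have "seq_diff (seq_add (x n) (w n)) (seq_add y z) =
      seq_add (seq_diff (x n) y) (seq_diff (w n) z)" for n
    by (auto simp: seq_ops_defs)
  then have bound: "lpnorm p (seq_diff (seq_add (x n) (w n)) (seq_add y z)) \<le>
      lpnorm p (seq_diff (x n) y) + lpnorm p (seq_diff (w n) z)" for n
    using lpnorm_add_le[OF lp_diff[OF assms(1) limits_lp(1)] lp_diff[OF assms(2) limits_lp(2)]]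
    by simp
  have "(\<lambda>n. lpnorm p (seq_diff (x n) y) + lpnorm p (seq_diff (w n) z)) \<longlonglongrightarrow> 0"
    using assms(3,4) by (intro tendsto_add_zero) (auto simp: lp_tendsto_def)
  then have "(\<lambda>n. lpnorm p (seq_diff (seq_add (x n) (w n)) (seq_add y z))) \<longlonglongrightarrow> 0"
    by (rule Lim_null_comparison[rotated]) (simp add: bound)
  then show ?thesis
    using limits_lp by (simp add: lp_tendsto_def lp_add)
qed

lemma lp_tendsto_subseq:
  assumes "lp_tendsto p x y" "strict_mono r"
  shows "lp_tendsto p (\<lambda>n. x (r n)) y"
  using assms LIMSEQ_subseq_LIMSEQ[of "\<lambda>n. lpnorm p (seq_diff (x n) y)" 0 r]
  by (simp add: lp_tendsto_def o_def)

lemma lp_tendsto_coordinate: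
  assumes "\<And>n. x n \<in> lp p" "lp_tendsto p x y"
  shows "(\<lambda>n. x n k) \<longlonglongrightarrow> y k"
proof -
  have bound: "cmod (x n k - y k) \<le> lpnorm p (seq_diff (x n) y)" for n
    using cmod_le_lpnorm[OF lp_diff[OF assms(1)], of y n k] assms(2)
    by (simp add: seq_diff_def lp_tendsto_def)
  have "(\<lambda>n. lpnorm p (seq_diff (x n) y)) \<longlonglongrightarrow> 0"
    using assms(2) by (simp add: lp_tendsto_def)
  then have "(\<lambda>n. x n k - y k) \<longlonglongrightarrow> 0"
    by (rule Lim_null_comparison[rotated]) (simp add: bound)
  then show ?thesis
    by (rule LIM_zero_cancel)
qed

end

section \<open>Bounded operators\<close>

definition lp_linear :: "real \<Rightarrow> bop \<Rightarrow> bool" where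
  "lp_linear p T \<longleftrightarrow>
     (\<forall>x\<in>lp p. \<forall>y\<in>lp p. T (seq_add x y) = seq_add (T x) (T y)) \<and>
     (\<forall>x\<in>lp p. \<forall>c. T (seq_scale c x) = seq_scale c (T x))"

definition lp_bounded_by :: "real \<Rightarrow> bop \<Rightarrow> real \<Rightarrow> bool" where
  "lp_bounded_by p T B \<longleftrightarrow> (\<forall>x\<in>lp p. T x \<in> lp p \<and> lpnorm p (T x) \<le> B * lpnorm p x)"

lemma lp_bounded_byD:
  assumes "lp_bounded_by p T B" "x \<in> lp p"
  shows "T x \<in> lp p" "lpnorm p (T x) \<le> B * lpnorm p x"
  using assms by (auto simp: lp_bounded_by_def)

lemma bounded_opI: "lp_linear p T \<Longrightarrow> lp_bounded_by p T B \<Longrightarrow> bounded_op p T"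
  unfolding bounded_op_def lp_linear_def lp_bounded_by_def by blast

lemma bounded_op_lp_linear: "bounded_op p T \<Longrightarrow> lp_linear p T"
  by (simp add: bounded_op_def lp_linear_def)

lemma bounded_opD:
  assumes "bounded_op p T"
  shows "x \<in> lp p \<Longrightarrow> T x \<in> lp p"
    and "x \<in> lp p \<Longrightarrow> y \<in> lp p \<Longrightarrow> T (seq_add x y) = seq_add (T x) (T y)"
    and "x \<in> lp p \<Longrightarrow> T (seq_scale c x) = seq_scale c (T x)"
  using assms by (auto simp: bounded_op_def)

lemma bounded_opE:
  assumes "bounded_op p T"
  obtains B where "0 < B" "lp_bounded_by p T B"
proof -
  obtain B where "\<And>x. x \<in> lp p \<Longrightarrow> lpnorm p (T x) \<le> B * lpnorm p x"
    using assms unfolding bounded_op_def by blast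
  then have "lpnorm p (T x) \<le> (\<bar>B\<bar> + 1) * lpnorm p x" if "x \<in> lp p" for x
    using that by (intro order_trans[OF _ mult_right_mono[of B "\<bar>B\<bar> + 1"]]) auto
  then show ?thesis
    using that[of "\<bar>B\<bar> + 1"] bounded_opD(1)[OF assms] by (simp add: lp_bounded_by_def)
qed

lemma bounded_op_zero_arg: "bounded_op p T \<Longrightarrow> T (\<lambda>k. 0) = (\<lambda>k. 0)"
  using bounded_opD(3)[of p T "\<lambda>k. 0" 0] by (simp add: seq_scale_def)

context lp_space
begin

lemma bounded_op_diff_arg:
  "bounded_op p T \<Longrightarrow> x \<in> lp p \<Longrightarrow> y \<in> lp p \<Longrightarrow> T (seq_diff x y) = seq_diff (T x) (T y)"
  by (simp add: seq_diff_conv_add bounded_opD lp_scale)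

lemma bounded_op_seq_sum_arg:
  assumes "bounded_op p T" "finite F" "\<And>i. i \<in> F \<Longrightarrow> x i \<in> lp p"
  shows "T (seq_sum x F) = seq_sum (\<lambda>i. T (x i)) F"
  using assms(2,3)
  by (induction F rule: finite_induct)
    (auto simp: seq_sum_insert bounded_opD[OF assms(1)] lp_seq_sum bounded_op_zero_arg[OF assms(1)])

lemma bounded_op_cong:
  assumes "bounded_op p T" "\<And>x. x \<in> lp p \<Longrightarrow> T x = U x"
  shows "bounded_op p U"
  using assms unfolding bounded_op_def by (simp add: lp_add lp_scale)

lemma bounded_op_id: "bounded_op p id"
  by (rule bounded_opI[of _ _ 1]) (auto simp: lp_linear_def lp_bounded_by_def)

lemma bounded_op_comp:
  assumes "bounded_op p T" "bounded_op p U"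
  shows "bounded_op p (T \<circ> U)"
proof -
  obtain A B where A_pos: "0 < A" and T_bound: "lp_bounded_by p T A"
    and U_bound: "lp_bounded_by p U B"
    using assms by (meson bounded_opE)
  have "lp_bounded_by p (T \<circ> U) (A * B)"
    unfolding lp_bounded_by_def
  proof (intro ballI conjI)
    fix x
    assume x_lp: "x \<in> lp p"
    note Ux = lp_bounded_byD[OF U_bound x_lp]
    show "(T \<circ> U) x \<in> lp p"
      using lp_bounded_byD(1)[OF T_bound Ux(1)] by simp
    show "lpnorm p ((T \<circ> U) x) \<le> A * B * lpnorm p x"
      using order_trans[OF lp_bounded_byD(2)[OF T_bound Ux(1)] mult_left_mono[OF Ux(2)]] A_pos
      by (simp add: mult.assoc)
  qed
  then show ?thesis
    using assms by (intro bounded_opI) (auto simp: lp_linear_def bounded_opD)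
qed

lemma lp_bounded_by_add:
  assumes "lp_bounded_by p T A" "lp_bounded_by p U B"
  shows "lp_bounded_by p (op_add T U) (A + B)"
  unfolding lp_bounded_by_def op_add_def
proof (intro ballI conjI)
  fix x
  assume x_lp: "x \<in> lp p"
  note Tx = lp_bounded_byD[OF assms(1) x_lp] and Ux = lp_bounded_byD[OF assms(2) x_lp]
  show "seq_add (T x) (U x) \<in> lp p"
    by (rule lp_add[OF Tx(1) Ux(1)])
  show "lpnorm p (seq_add (T x) (U x)) \<le> (A + B) * lpnorm p x"
    using lpnorm_add_le[OF Tx(1) Ux(1)] Tx(2) Ux(2) by (simp add: distrib_right)
qed

lemma lp_bounded_by_scale: "lp_bounded_by p T B \<Longrightarrow> lp_bounded_by p (op_scale c T) (cmod c * B)"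
  by (simp add: lp_bounded_by_def op_scale_def lp_scale lpnorm_scale mult_left_mono mult.assoc)

lemma lp_linear_add: "lp_linear p T \<Longrightarrow> lp_linear p U \<Longrightarrow> lp_linear p (op_add T U)"
  by (auto simp: lp_linear_def op_add_def seq_ops_defs algebra_simps)

lemma lp_linear_scale: "lp_linear p T \<Longrightarrow> lp_linear p (op_scale c T)"
  by (auto simp: lp_linear_def op_scale_def seq_ops_defs algebra_simps)

lemma bounded_op_add: "bounded_op p T \<Longrightarrow> bounded_op p U \<Longrightarrow> bounded_op p (op_add T U)"
  by (metis bounded_opE bounded_opI bounded_op_lp_linear lp_bounded_by_add lp_linear_add)

lemma bounded_op_scale: "bounded_op p T \<Longrightarrow> bounded_op p (op_scale c T)"
  by (metis bounded_opE bounded_opI bounded_op_lp_linear lp_bounded_by_scale lp_linear_scale)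

lemma opnorm_le:
  assumes "lp_bounded_by p T B" "0 \<le> B"
  shows "opnorm p T \<le> B"
  unfolding opnorm_def
proof (rule cSup_least)
  show "{lpnorm p (T x) |x. x \<in> lp p \<and> lpnorm p x \<le> 1} \<noteq> {}"
    using lp_zero by (auto intro!: exI[of _ "\<lambda>k. 0"])
next
  fix r
  assume "r \<in> {lpnorm p (T x) |x. x \<in> lp p \<and> lpnorm p x \<le> 1}"
  then obtain x where "r = lpnorm p (T x)" "x \<in> lp p" "lpnorm p x \<le> 1"
    by blast
  then show "r \<le> B"
    using order_trans[OF lp_bounded_byD(2)[OF assms(1)] mult_left_le] assms(2) by simp
qed

lemma lpnorm_le_opnorm:
  assumes "bounded_op p T" "x \<in> lp p" "lpnorm p x \<le> 1"
  shows "lpnorm p (T x) \<le> opnorm p T"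
proof -
  obtain B where B_pos: "0 < B" and T_bound: "lp_bounded_by p T B"
    using assms(1) by (rule bounded_opE)
  have "bdd_above {lpnorm p (T x) |x. x \<in> lp p \<and> lpnorm p x \<le> 1}"
  proof (rule bdd_aboveI[of _ B], clarify)
    fix x
    assume "x \<in> lp p" "lpnorm p x \<le> 1"
    then show "lpnorm p (T x) \<le> B"
      using order_trans[OF lp_bounded_byD(2)[OF T_bound] mult_left_le] B_pos by simp
  qed
  then show ?thesis
    unfolding opnorm_def using assms by (intro cSup_upper) auto
qed

lemma lp_tendsto_bounded_op:
  assumes "bounded_op p T" "\<And>n. x n \<in> lp p" "lp_tendsto p x y"
  shows "lp_tendsto p (\<lambda>n. T (x n)) (T y)"
proof -
  obtain B where T_bound: "lp_bounded_by p T B"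
    using assms(1) by (rule bounded_opE)
  have y_lp: "y \<in> lp p"
    using assms(3) by (simp add: lp_tendsto_def)
  have "lpnorm p (seq_diff (T (x n)) (T y)) \<le> B * lpnorm p (seq_diff (x n) y)" for n
    using lp_bounded_byD(2)[OF T_bound lp_diff[OF assms(2) y_lp]]
    by (simp add: bounded_op_diff_arg[OF assms(1,2) y_lp])
  then show ?thesis
    by (rule lp_tendsto_compose[OF assms(3) bounded_opD(1)[OF assms(1) y_lp]])
qed

end

section \<open>Compact operators and the Calkin algebra\<close>

definition essentially_eq :: "real \<Rightarrow> bop \<Rightarrow> bop \<Rightarrow> bool" where
  "essentially_eq p S T \<longleftrightarrow> compact_op p (\<lambda>x. seq_diff (S x) (T x))"

lemma compact_op_iff:
  "compact_op p K \<longleftrightarrow> bounded_op p K \<and>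
     (\<forall>x. (\<forall>n. x n \<in> lp p \<and> lpnorm p (x n) \<le> 1) \<longrightarrow>
        (\<exists>r y. strict_mono (r :: nat \<Rightarrow> nat) \<and> lp_tendsto p (\<lambda>n. K (x (r n))) y))"
  by (simp add: compact_op_def lp_tendsto_def)

lemma compact_op_bounded: "compact_op p K \<Longrightarrow> bounded_op p K"
  by (simp add: compact_op_def)

context lp_space
begin

lemma compact_op_subseqE:
  assumes compact: "compact_op p K" and x_lp: "\<And>n. x n \<in> lp p" and x_bound: "\<And>n. lpnorm p (x n) \<le> B"
  obtains r :: "nat \<Rightarrow> nat" and y where "strict_mono r" "lp_tendsto p (\<lambda>n. K (x (r n))) y"
proof -
  note bounded_K = compact_op_bounded[OF compact]
  define b where "b = max B 1"
  have b_pos: "0 < b" and x_le_b: "lpnorm p (x n) \<le> b" for n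
    using x_bound[of n] by (auto simp: b_def)
  define u where "u n = seq_scale (inverse b) (x n)" for n
  have u_lp: "u n \<in> lp p" and u_le_1: "lpnorm p (u n) \<le> 1"
    and K_u: "seq_scale b (K (u n)) = K (x n)" for n
  proof -
    show "u n \<in> lp p"
      by (simp add: u_def lp_scale x_lp)
    show "lpnorm p (u n) \<le> 1"
      using mult_left_mono[OF x_le_b, of "inverse b" n] b_pos
      by (simp add: u_def lpnorm_scale x_lp norm_inverse)
    have "K (u n) = seq_scale (inverse b) (K (x n))"
      unfolding u_def by (rule bounded_opD(3)[OF bounded_K x_lp])
    then show "seq_scale b (K (u n)) = K (x n)"
      using b_pos by (simp add: seq_scale_def flip: mult.assoc)
  qed
  obtain r y where r_mono: "strict_mono r" and r_lim: "lp_tendsto p (\<lambda>n. K (u (r n))) y"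
    using compact u_lp u_le_1 unfolding compact_op_iff by metis
  have "lp_tendsto p (\<lambda>n. op_scale b id (K (u (r n)))) (op_scale b id y)"
    by (rule lp_tendsto_bounded_op[OF bounded_op_scale[OF bounded_op_id] _ r_lim])
      (rule bounded_opD(1)[OF bounded_K u_lp])
  then show thesis
    using that[OF r_mono] by (simp add: op_scale_def K_u)
qed

lemma compact_op_cong:
  assumes "compact_op p K" "\<And>x. x \<in> lp p \<Longrightarrow> K x = L x"
  shows "compact_op p L"
  unfolding compact_op_iff
proof (intro conjI allI impI)
  show "bounded_op p L"
    using assms by (rule bounded_op_cong[OF compact_op_bounded])
next
  fix x :: "nat \<Rightarrow> seq"
  assume unit_ball: "\<forall>n. x n \<in> lp p \<and> lpnorm p (x n) \<le> 1"
  then have "L (x n) = K (x n)" for n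
    using assms(2) by simp
  then show "\<exists>r y. strict_mono r \<and> lp_tendsto p (\<lambda>n. L (x (r n))) y"
    using assms(1) unit_ball by (simp add: compact_op_iff)
qed

lemma compact_op_zero: "compact_op p (\<lambda>x k. 0)"
  unfolding compact_op_iff
proof (intro conjI allI impI exI)
  show "bounded_op p (\<lambda>x k. 0)"
    by (rule bounded_opI[of _ _ 0]) (auto simp: lp_linear_def lp_bounded_by_def seq_ops_defs)
  show "lp_tendsto p (\<lambda>n k. 0) (\<lambda>k. 0)"
    by (simp add: lp_tendsto_def seq_diff_def)
qed (rule strict_mono_id)

lemma compact_op_comp_left:
  assumes "compact_op p K" "bounded_op p T"
  shows "compact_op p (T \<circ> K)"
  unfolding compact_op_iff
proof (intro conjI allI impI)
  show "bounded_op p (T \<circ> K)"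
    by (rule bounded_op_comp[OF assms(2) compact_op_bounded[OF assms(1)]])
next
  fix x :: "nat \<Rightarrow> seq"
  assume unit_ball: "\<forall>n. x n \<in> lp p \<and> lpnorm p (x n) \<le> 1"
  obtain r y where r_mono: "strict_mono r" and r_lim: "lp_tendsto p (\<lambda>n. K (x (r n))) y"
    by (rule compact_op_subseqE[OF assms(1), of x 1]) (use unit_ball in auto)
  have "lp_tendsto p (\<lambda>n. T (K (x (r n)))) (T y)"
    using lp_tendsto_bounded_op[OF assms(2) _ r_lim] unit_ball
      bounded_opD(1)[OF compact_op_bounded[OF assms(1)]]
    by simp
  then show "\<exists>r y. strict_mono r \<and> lp_tendsto p (\<lambda>n. (T \<circ> K) (x (r n))) y"
    using r_mono by auto
qed

lemma compact_op_comp_right: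
  assumes "compact_op p K" "bounded_op p T"
  shows "compact_op p (K \<circ> T)"
  unfolding compact_op_iff
proof (intro conjI allI impI)
  show "bounded_op p (K \<circ> T)"
    by (rule bounded_op_comp[OF compact_op_bounded[OF assms(1)] assms(2)])
next
  fix x :: "nat \<Rightarrow> seq"
  assume unit_ball: "\<forall>n. x n \<in> lp p \<and> lpnorm p (x n) \<le> 1"
  have "T (x n) \<in> lp p" "lpnorm p (T (x n)) \<le> opnorm p T" for n
    using unit_ball bounded_opD(1)[OF assms(2)] lpnorm_le_opnorm[OF assms(2)] by auto
  then obtain r y where "strict_mono r" "lp_tendsto p (\<lambda>n. K (T (x (r n)))) y"
    by (rule compact_op_subseqE[OF assms(1), of "\<lambda>n. T (x n)"])
  then show "\<exists>r y. strict_mono r \<and> lp_tendsto p (\<lambda>n. (K \<circ> T) (x (r n))) y"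
    by auto
qed

lemma compact_op_scale: "compact_op p K \<Longrightarrow> compact_op p (op_scale c K)"
  using compact_op_comp_left[OF _ bounded_op_scale[OF bounded_op_id]]
  by (simp add: op_scale_def o_def)

lemma compact_op_add:
  assumes "compact_op p K" "compact_op p L"
  shows "compact_op p (op_add K L)"
  unfolding compact_op_iff
proof (intro conjI allI impI)
  show "bounded_op p (op_add K L)"
    using assms by (intro bounded_op_add compact_op_bounded)
next
  fix x :: "nat \<Rightarrow> seq"
  assume unit_ball: "\<forall>n. x n \<in> lp p \<and> lpnorm p (x n) \<le> 1"
  obtain r y where r_mono: "strict_mono r" and r_lim: "lp_tendsto p (\<lambda>n. K (x (r n))) y"
    by (rule compact_op_subseqE[OF assms(1), of x 1]) (use unit_ball in auto)
  obtain s z where s_mono: "strict_mono s" and s_lim: "lp_tendsto p (\<lambda>n. L (x (r (s n)))) z"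
    by (rule compact_op_subseqE[OF assms(2), of "\<lambda>n. x (r n)" 1]) (use unit_ball in auto)
  have "lp_tendsto p (\<lambda>n. op_add K L (x (r (s n)))) (seq_add y z)"
    unfolding op_add_def using unit_ball assms
    by (intro lp_tendsto_add[OF _ _ lp_tendsto_subseq[OF r_lim s_mono] s_lim])
      (auto intro: bounded_opD(1)[OF compact_op_bounded])
  then show "\<exists>r y. strict_mono r \<and> lp_tendsto p (\<lambda>n. op_add K L (x (r n))) y"
    using strict_mono_o[OF r_mono s_mono] unfolding o_def by blast
qed

lemma essentially_eq_of_eq: "(\<And>x. x \<in> lp p \<Longrightarrow> S x = T x) \<Longrightarrow> essentially_eq p S T"
  unfolding essentially_eq_def
  by (rule compact_op_cong[OF compact_op_zero]) (simp add: seq_diff_def)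

lemma essentially_eq_sym:
  assumes "essentially_eq p S T"
  shows "essentially_eq p T S"
  using compact_op_scale[OF assms[unfolded essentially_eq_def], of "-1"]
  unfolding essentially_eq_def
  by (rule compact_op_cong) (simp add: op_scale_def seq_ops_defs)

lemma essentially_eq_trans [trans]:
  assumes "essentially_eq p S T" "essentially_eq p T U"
  shows "essentially_eq p S U"
  using compact_op_add[OF assms[unfolded essentially_eq_def]] unfolding essentially_eq_def
  by (rule compact_op_cong) (simp add: op_add_def seq_ops_defs)

lemma essentially_eq_add:
  assumes "essentially_eq p S T" "essentially_eq p S' T'"
  shows "essentially_eq p (op_add S S') (op_add T T')"
  using compact_op_add[OF assms[unfolded essentially_eq_def]] unfolding essentially_eq_def
  by (rule compact_op_cong) (simp add: op_add_def seq_ops_defs algebra_simps)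

lemma essentially_eq_scale:
  assumes "essentially_eq p S T"
  shows "essentially_eq p (op_scale c S) (op_scale c T)"
  using compact_op_scale[OF assms[unfolded essentially_eq_def], of c] unfolding essentially_eq_def
  by (rule compact_op_cong) (simp add: op_scale_def seq_ops_defs algebra_simps)

lemma bounded_op_essentially_eq:
  assumes "essentially_eq p S T" "bounded_op p S"
  shows "bounded_op p T"
proof (rule bounded_op_cong)
  show "bounded_op p (op_add S (op_scale (-1) (\<lambda>x. seq_diff (S x) (T x))))"
    using assms by (intro bounded_op_add bounded_op_scale)
      (simp_all add: essentially_eq_def compact_op_bounded)
qed (simp add: op_add_def op_scale_def seq_ops_defs)

lemma essentially_eq_comp_left:
  assumes "essentially_eq p S T" "bounded_op p S" "bounded_op p V"
  shows "essentially_eq p (V \<circ> S) (V \<circ> T)"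
  unfolding essentially_eq_def
proof (rule compact_op_cong)
  show "compact_op p (V \<circ> (\<lambda>x. seq_diff (S x) (T x)))"
    using assms by (intro compact_op_comp_left) (simp_all add: essentially_eq_def)
  fix x
  assume "x \<in> lp p"
  then show "(V \<circ> (\<lambda>x. seq_diff (S x) (T x))) x = seq_diff ((V \<circ> S) x) ((V \<circ> T) x)"
    using bounded_opD(1)[OF assms(2)] bounded_opD(1)[OF bounded_op_essentially_eq[OF assms(1,2)]]
    by (simp add: bounded_op_diff_arg[OF assms(3)])
qed

lemma essentially_eq_comp_right:
  assumes "essentially_eq p S T" "bounded_op p V"
  shows "essentially_eq p (S \<circ> V) (T \<circ> V)"
  using compact_op_comp_right[of "\<lambda>x. seq_diff (S x) (T x)" V] assms
  by (simp add: essentially_eq_def o_def)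

lemma calkin_pi_self: "bounded_op p T \<Longrightarrow> T \<in> calkin_pi p T"
  using essentially_eq_of_eq[OF refl, of T] by (simp add: calkin_pi_def essentially_eq_def)

lemma calkin_pi_eq_iff:
  assumes "bounded_op p S"
  shows "calkin_pi p S = calkin_pi p T \<longleftrightarrow> essentially_eq p S T"
proof
  assume "calkin_pi p S = calkin_pi p T"
  then show "essentially_eq p S T"
    using calkin_pi_self[OF assms] by (simp add: calkin_pi_def essentially_eq_def)
next
  assume "essentially_eq p S T"
  then show "calkin_pi p S = calkin_pi p T"
    unfolding calkin_pi_def essentially_eq_def[symmetric]
    using essentially_eq_trans essentially_eq_sym by blast
qed

lemma rep_calkin_pi:
  assumes "bounded_op p T"
  shows "bounded_op p (rep (calkin_pi p T))" "essentially_eq p (rep (calkin_pi p T)) T"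
  using someI[of "\<lambda>S. S \<in> calkin_pi p T", OF calkin_pi_self[OF assms]]
  by (auto simp: rep_def calkin_pi_def essentially_eq_def)

lemma calkin_pi_rep_scale:
  assumes "bounded_op p T"
  shows "calkin_pi p (op_scale c (rep (calkin_pi p T))) = calkin_pi p (op_scale c T)"
  using rep_calkin_pi[OF assms]
  by (simp add: calkin_pi_eq_iff bounded_op_scale essentially_eq_scale)

lemma calkin_pi_rep_add:
  assumes "bounded_op p T" "bounded_op p U"
  shows "calkin_pi p (op_add (rep (calkin_pi p T)) (rep (calkin_pi p U))) =
      calkin_pi p (op_add T U)"
  using rep_calkin_pi[OF assms(1)] rep_calkin_pi[OF assms(2)]
  by (simp add: calkin_pi_eq_iff bounded_op_add essentially_eq_add)

lemma calkin_pi_rep_comp: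
  assumes "bounded_op p T" "bounded_op p U"
  shows "calkin_pi p (rep (calkin_pi p T) \<circ> rep (calkin_pi p U)) = calkin_pi p (T \<circ> U)"
proof -
  note rep_T = rep_calkin_pi[OF assms(1)] and rep_U = rep_calkin_pi[OF assms(2)]
  have "essentially_eq p (rep (calkin_pi p T) \<circ> rep (calkin_pi p U)) (T \<circ> rep (calkin_pi p U))"
    by (rule essentially_eq_comp_right[OF rep_T(2) rep_U(1)])
  also have "essentially_eq p (T \<circ> rep (calkin_pi p U)) (T \<circ> U)"
    by (rule essentially_eq_comp_left[OF rep_U(2,1) assms(1)])
  finally show ?thesis
    by (simp add: calkin_pi_eq_iff bounded_op_comp rep_T rep_U)
qed

lemma opnorm_nonneg: "bounded_op p T \<Longrightarrow> 0 \<le> opnorm p T"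
  using lpnorm_le_opnorm[of T "\<lambda>k. 0"] order_trans[OF lpnorm_nonneg] by simp

lemma calkin_norm_le_opnorm:
  assumes "bounded_op p T"
  shows "calkin_norm p (calkin_pi p T) \<le> opnorm p T"
  unfolding calkin_norm_def
proof (rule cINF_lower)
  show "bdd_below (opnorm p ` calkin_pi p T)"
    by (rule bdd_belowI2[of _ 0]) (simp add: calkin_pi_def opnorm_nonneg)
qed (rule calkin_pi_self[OF assms])

end

section \<open>Disjointly supported sequences\<close>

definition normalized_disjoint :: "real \<Rightarrow> (nat \<Rightarrow> seq) \<Rightarrow> bool" where
  "normalized_disjoint p x \<longleftrightarrow>
     (\<forall>n. x n \<in> lp p \<and> lpnorm p (x n) = 1) \<and> disjoint_family (\<lambda>n. seq_supp (x n))"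

lemma powr_exponent_le:
  fixes a b s t :: real
  assumes "0 < a" "\<And>m::nat. 0 < m \<Longrightarrow> a * m powr s \<le> b * m powr t"
  shows "s \<le> t"
proof (rule ccontr)
  assume "\<not> s \<le> t"
  then have pos: "0 < s - t"
    by simp
  define R where "R = \<bar>b\<bar> / a + 1"
  have R_pos: "0 < R" and R_gt: "b / a < R"
    using assms(1) divide_right_mono[OF abs_ge_self, of a b] by (auto simp: R_def add_nonneg_pos)
  obtain m :: nat where m_gt: "R powr (1 / (s - t)) < m"
    using reals_Archimedean2 by blast
  then have "0 < real m"
    using order_le_less_trans[OF powr_ge_zero] by blast
  then have "m powr (s - t) \<le> b / a"
    using assms(1) assms(2)[of m] by (simp add: powr_diff field_simps)
  moreover have "R < m powr (s - t)"
    using powr_less_mono2[OF pos _ m_gt] R_pos pos by (simp add: powr_powr)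
  ultimately show False
    using R_gt by simp
qed

lemma cnj_sgn_mult: "cnj (sgn z) * z = cmod z"
proof -
  have "cnj (sgn z) * z = z * cnj z / cmod z"
    by (simp add: sgn_eq)
  also have "\<dots> = cmod z"
    by (simp add: power2_eq_square flip: complex_norm_square)
  finally show ?thesis .
qed

context lp_space
begin

lemma normalized_disjoint_coordinate_growth:
  fixes e :: real
  assumes T_op: "bounded_op p T" and T_bound: "lp_bounded_by p T B" and B_nonneg: "0 \<le> B"
    and normalized: "normalized_disjoint p x"
    and F_finite: "finite F" and F_large: "\<And>n. n \<in> F \<Longrightarrow> e \<le> cmod (T (x n) k)"
  shows "e * card F \<le> B * card F powr (1 / p)"
proof -
  have x_lp: "x n \<in> lp p" and x_norm: "lpnorm p (x n) = 1" for n
    using normalized by (auto simp: normalized_disjoint_def)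
  define u where "u n = seq_scale (cnj (sgn (T (x n) k))) (x n)" for n
  have u_lp: "u n \<in> lp p" and u_le_1: "lpnorm p (u n) \<le> 1" for n
    by (auto simp: u_def lp_scale lpnorm_scale x_lp x_norm norm_sgn)
  have disj: "disjoint_family_on (\<lambda>n. seq_supp (u n)) F"
    using normalized unfolding normalized_disjoint_def disjoint_family_on_def
    by (auto simp: u_def seq_supp_def seq_scale_def)
  have "T (u n) k = cnj (sgn (T (x n) k)) * T (x n) k" for n
    unfolding u_def bounded_opD(3)[OF T_op x_lp] by (simp add: seq_scale_def)
  then have "T (u n) k = cmod (T (x n) k)" for n
    by (simp add: cnj_sgn_mult)
  then have "T (seq_sum u F) k = (\<Sum>n\<in>F. complex_of_real (cmod (T (x n) k)))"
    using bounded_op_seq_sum_arg[OF T_op F_finite u_lp] by (simp add: seq_sum_def)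
  moreover have "e * card F \<le> (\<Sum>n\<in>F. cmod (T (x n) k))"
    using sum_mono[OF F_large] by (simp add: mult.commute)
  ultimately have "e * card F \<le> cmod (T (seq_sum u F) k)"
    by (simp add: sum_nonneg flip: of_real_sum)
  also have "\<dots> \<le> lpnorm p (T (seq_sum u F))"
    by (intro cmod_le_lpnorm bounded_opD(1)[OF T_op] lp_seq_sum F_finite u_lp)
  also have "\<dots> \<le> B * lpnorm p (seq_sum u F)"
    by (intro lp_bounded_byD(2)[OF T_bound] lp_seq_sum F_finite u_lp)
  also have "\<dots> \<le> B * card F powr (1 / p)"
    using lpnorm_seq_sum_disjoint_le[OF F_finite u_lp disj _ u_le_1] B_nonneg
    by (simp add: mult_left_mono)
  finally show ?thesis .
qed

text \<open>Weak nullness is where \<open>p > 1\<close> enters: \<open>m\<close> disjoint unit vectors have a sum of norm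
  \<open>m powr (1 / p)\<close>, whereas a functional staying away from zero on them grows like \<open>m\<close>.\<close>

lemma normalized_disjoint_coordinate_tendsto_0:
  assumes "bounded_op p T" "normalized_disjoint p x"
  shows "(\<lambda>n. T (x n) k) \<longlonglongrightarrow> 0"
proof (rule ccontr)
  assume "\<not> (\<lambda>n. T (x n) k) \<longlonglongrightarrow> 0"
  then obtain e where e_pos: "0 < e" and frequently_large: "infinite {n. e \<le> cmod (T (x n) k)}"
    by (auto simp: tendsto_iff not_less eventually_sequentially infinite_nat_iff_unbounded_le)
  obtain B where B_pos: "0 < B" and T_bound: "lp_bounded_by p T B"
    using assms(1) by (rule bounded_opE)
  have "e * real m powr 1 \<le> B * real m powr (1 / p)" for m
  proof -
    obtain F where "finite F" "card F = m" "F \<subseteq> {n. e \<le> cmod (T (x n) k)}"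
      using infinite_arbitrarily_large[OF frequently_large] by blast
    then show ?thesis
      using normalized_disjoint_coordinate_growth[OF assms(1) T_bound _ assms(2), of F] B_pos
      by auto
  qed
  then have "1 \<le> 1 / p"
    by (rule powr_exponent_le[OF e_pos])
  then show False
    using p_gt_1 by simp
qed

lemma compact_op_normalized_disjoint_tendsto_0:
  assumes compact: "compact_op p K" and normalized: "normalized_disjoint p x"
  shows "(\<lambda>n. lpnorm p (K (x n))) \<longlonglongrightarrow> 0"
proof (rule ccontr)
  note bounded_K = compact_op_bounded[OF compact]
  have x_lp: "x n \<in> lp p" and x_norm: "lpnorm p (x n) = 1" for n
    using normalized by (auto simp: normalized_disjoint_def)
  assume "\<not> (\<lambda>n. lpnorm p (K (x n))) \<longlonglongrightarrow> 0"
  then obtain e where e_pos: "0 < e" and frequently_large: "infinite {n. e \<le> lpnorm p (K (x n))}"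
    by (auto simp: tendsto_iff not_less eventually_sequentially infinite_nat_iff_unbounded_le)
  then obtain s :: "nat \<Rightarrow> nat" where s_mono: "strict_mono s"
    and s_large: "\<And>n. e \<le> lpnorm p (K (x (s n)))"
    using infinite_enumerate by blast
  obtain r y where r_mono: "strict_mono r" and r_lim: "lp_tendsto p (\<lambda>n. K (x (s (r n)))) y"
    by (rule compact_op_subseqE[OF compact, of "\<lambda>n. x (s n)" 1]) (auto simp: x_lp x_norm)
  have "y k = 0" for k
  proof (rule LIMSEQ_unique)
    show "(\<lambda>n. K (x (s (r n))) k) \<longlonglongrightarrow> y k"
      by (rule lp_tendsto_coordinate[OF bounded_opD(1)[OF bounded_K x_lp] r_lim])
    show "(\<lambda>n. K (x (s (r n))) k) \<longlonglongrightarrow> 0"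
      using LIMSEQ_subseq_LIMSEQ[OF normalized_disjoint_coordinate_tendsto_0
          strict_mono_o[OF s_mono r_mono], OF bounded_K normalized]
      by (simp add: o_def)
  qed
  then have "(\<lambda>n. lpnorm p (K (x (s (r n))))) \<longlonglongrightarrow> 0"
    using r_lim by (simp add: lp_tendsto_def seq_diff_def)
  then have "e \<le> 0"
    by (rule LIMSEQ_le_const) (use s_large in auto)
  then show False
    using e_pos by simp
qed

lemma eigenvalue_le_calkin_norm:
  assumes T_op: "bounded_op p T" and normalized: "normalized_disjoint p x"
    and eigen: "\<And>n. T (x n) = seq_scale z (x n)"
  shows "cmod z \<le> calkin_norm p (calkin_pi p T)"
  unfolding calkin_norm_def
proof (rule cINF_greatest)
  show "calkin_pi p T \<noteq> {}"
    using calkin_pi_self[OF T_op] by blast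
next
  have x_lp: "x n \<in> lp p" and x_norm: "lpnorm p (x n) = 1" for n
    using normalized by (auto simp: normalized_disjoint_def)
  fix S
  assume "S \<in> calkin_pi p T"
  then have S_op: "bounded_op p S" and compact: "compact_op p (\<lambda>x. seq_diff (S x) (T x))"
    by (auto simp: calkin_pi_def)
  have bound: "cmod z \<le> opnorm p S + lpnorm p (seq_diff (S (x n)) (T (x n)))" for n
  proof -
    note images_lp = bounded_opD(1)[OF S_op x_lp[of n]] bounded_opD(1)[OF T_op x_lp[of n]]
    have "cmod z = lpnorm p (T (x n))"
      by (simp add: eigen lpnorm_scale x_lp x_norm)
    also have "\<dots> \<le> lpnorm p (S (x n)) + lpnorm p (seq_diff (T (x n)) (S (x n)))"
      by (rule lpnorm_le_add_diff[OF images_lp(2,1)])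
    also have "\<dots> \<le> opnorm p S + lpnorm p (seq_diff (S (x n)) (T (x n)))"
      using lpnorm_le_opnorm[OF S_op x_lp, of n]
      by (simp add: x_norm lpnorm_diff_commute[OF images_lp])
    finally show ?thesis .
  qed
  have "(\<lambda>n. opnorm p S + lpnorm p (seq_diff (S (x n)) (T (x n)))) \<longlonglongrightarrow> opnorm p S + 0"
    by (intro tendsto_add tendsto_const
        compact_op_normalized_disjoint_tendsto_0[OF compact normalized])
  then show "cmod z \<le> opnorm p S"
    using bound by (intro LIMSEQ_le_const[of _ "opnorm p S"]) auto
qed

end

section \<open>Extensions obtained by sampling at a dense sequence\<close>

definition dense_points :: "(nat \<Rightarrow> real) \<Rightarrow> bool" where
  "dense_points t \<longleftrightarrow> range t \<subseteq> {0..1} \<and> {0..1} \<subseteq> closure (range t)"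

lemma ex_inj_dense_points: "\<exists>t. inj t \<and> dense_points t"
proof -
  define D where "D = {0<..<1::real} \<inter> \<rat>"
  have closure: "closure D = {0..1}"
    using closure_open_Int_superset[of "{0<..<1::real}" \<rat>] by (simp add: D_def Rats_closure_real)
  have "infinite D"
    using closure finite_imp_closed[of D] by (metis closure_closed infinite_Icc zero_less_one)
  moreover have "countable D"
    unfolding D_def by (intro countable_Int2 countable_rat)
  ultimately have "bij_betw (from_nat_into D) UNIV D"
    by (intro bij_betw_from_nat_into)
  then show ?thesis
    using closure closure_subset[of D]
    by (intro exI[of _ "from_nat_into D"]) (auto simp: bij_betw_def dense_points_def)
qed

lemma cmod_le_supnorm:
  assumes "f \<in> C01" "s \<in> {0..1}"
  shows "cmod (f s) \<le> supnorm f"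
proof -
  have "compact ((\<lambda>s. cmod (f s)) ` {0..1})"
    using assms(1) by (intro compact_continuous_image continuous_on_norm) (auto simp: C01_def)
  then show ?thesis
    unfolding supnorm_def using assms(2)
    by (intro cSup_upper) (auto dest: compact_imp_bounded bounded_imp_bdd_above)
qed

lemma supnorm_le_dense_points:
  assumes "dense_points t" "f \<in> C01" "\<And>i. cmod (f (t i)) \<le> B"
  shows "supnorm f \<le> B"
proof -
  have closure: "closure (range t) = {0..1}"
    using assms(1) closure_minimal[of "range t" "{0..1}"] by (auto simp: dense_points_def)
  have "cmod (f s) \<le> B" if "s \<in> {0..1}" for s
    using that assms(2,3) continuous_on_closure_norm_le[of "range t" f B s]
    by (simp add: closure C01_def)
  then show ?thesis
    unfolding supnorm_def by (intro cSup_least) auto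
qed

locale linf_representation = lp_space p for p +
  fixes M :: "(nat \<Rightarrow> complex) \<Rightarrow> bop" and K :: real
  assumes K_nonneg: "0 \<le> K"
    and linear: "lp_linear p (M c)"
    and bounded_by: "(\<And>i. cmod (c i) \<le> B) \<Longrightarrow> lp_bounded_by p (M c) (K * B)"
    and add: "M (\<lambda>i. c i + d i) = op_add (M c) (M d)"
    and scale: "M (\<lambda>i. a * c i) = op_scale a (M c)"
    and mult: "M (\<lambda>i. c i * d i) = M c \<circ> M d"
    and one: "M (\<lambda>i. 1) = id"
    and eigenvectors: "\<exists>x. normalized_disjoint p x \<and> (\<forall>c n. M c (x n) = seq_scale (c i) (x n))"
begin

lemma bounded_op_M: "(\<And>i. cmod (c i) \<le> B) \<Longrightarrow> bounded_op p (M c)"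
  by (rule bounded_opI[OF linear bounded_by])

lemma opnorm_M_le:
  assumes "\<And>i. cmod (c i) \<le> B"
  shows "opnorm p (M c) \<le> K * B"
proof (rule opnorm_le[OF bounded_by[OF assms]])
  have "0 \<le> B"
    using order_trans[OF norm_ge_zero assms] .
  then show "0 \<le> K * B"
    using K_nonneg by simp
qed

lemma cmod_le_calkin_norm_M:
  assumes "\<And>i. cmod (c i) \<le> B"
  shows "cmod (c i) \<le> calkin_norm p (calkin_pi p (M c))"
proof -
  obtain x where "normalized_disjoint p x" "\<And>n. M c (x n) = seq_scale (c i) (x n)"
    using eigenvectors by blast
  then show ?thesis
    by (rule eigenvalue_le_calkin_norm[OF bounded_op_M[OF assms]])
qed

context
  fixes t :: "nat \<Rightarrow> real"
  assumes t_dense: "dense_points t"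
begin

lemma cmod_sample_le: "f \<in> C01 \<Longrightarrow> cmod ((f \<circ> t) i) \<le> supnorm f"
  using t_dense cmod_le_supnorm[of f "t i"] by (simp add: dense_points_def image_subset_iff)

lemma bounded_op_sample: "f \<in> C01 \<Longrightarrow> bounded_op p (M (f \<circ> t))"
  by (rule bounded_op_M[OF cmod_sample_le])

lemma sample_add: "M ((\<lambda>s. f s + g s) \<circ> t) = op_add (M (f \<circ> t)) (M (g \<circ> t))"
  using add[of "f \<circ> t" "g \<circ> t"] by (simp add: o_def)

lemma sample_scale: "M ((\<lambda>s. c * f s) \<circ> t) = op_scale c (M (f \<circ> t))"
  using scale[of c "f \<circ> t"] by (simp add: o_def)

lemma sample_mult: "M ((\<lambda>s. f s * g s) \<circ> t) = M (f \<circ> t) \<circ> M (g \<circ> t)"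
  using mult[of "f \<circ> t" "g \<circ> t"] by (simp add: o_def)

lemma supnorm_le_calkin_norm_sample:
  assumes "f \<in> C01"
  shows "supnorm f \<le> calkin_norm p (calkin_pi p (M (f \<circ> t)))"
  using cmod_le_calkin_norm_M[of "f \<circ> t", OF cmod_sample_le[OF assms]]
  by (intro supnorm_le_dense_points[OF t_dense assms]) simp

lemma iso_lift_sample: "iso_lift p (\<lambda>f. M (f \<circ> t))"
  unfolding iso_lift_def
proof (intro conjI ballI allI exI)
  fix f
  assume f_C01: "f \<in> C01"
  show "bounded_op p (M (f \<circ> t))"
    by (rule bounded_op_sample[OF f_C01])
  show "1 * supnorm f \<le> opnorm p (M (f \<circ> t))"
    using order_trans[OF supnorm_le_calkin_norm_sample calkin_norm_le_opnorm]
      bounded_op_sample f_C01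
    by simp
  show "opnorm p (M (f \<circ> t)) \<le> K * supnorm f"
    by (rule opnorm_M_le[OF cmod_sample_le[OF f_C01]])
qed (simp_all add: op_eq_def sample_add sample_scale sample_mult one)

lemma iso_ext_sample: "iso_ext p (\<lambda>f. calkin_pi p (M (f \<circ> t)))"
  unfolding iso_ext_def
proof (intro conjI ballI allI exI)
  fix f
  assume f_C01: "f \<in> C01"
  show "calkin_pi p (M (f \<circ> t)) \<in> calkin p"
    using bounded_op_sample[OF f_C01] by (simp add: calkin_def)
  show "1 * supnorm f \<le> calkin_norm p (calkin_pi p (M (f \<circ> t)))"
    using supnorm_le_calkin_norm_sample[OF f_C01] by simp
  show "calkin_norm p (calkin_pi p (M (f \<circ> t))) \<le> K * supnorm f"
    using calkin_norm_le_opnorm[OF bounded_op_sample[OF f_C01]]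
      opnorm_M_le[OF cmod_sample_le[OF f_C01]]
    by (rule order_trans)
qed (simp_all add: sample_add sample_scale sample_mult one calkin_pi_rep_add
    calkin_pi_rep_scale calkin_pi_rep_comp bounded_op_sample)

lemma trivial_ext_sample: "trivial_ext p (\<lambda>f. calkin_pi p (M (f \<circ> t)))"
  unfolding trivial_ext_def using iso_ext_sample iso_lift_sample by blast

end

end

section \<open>Diagonal operators\<close>

definition diag_op :: "(nat \<Rightarrow> complex) \<Rightarrow> bop" where
  "diag_op c x = (\<lambda>m. c (fst (prod_decode m)) * x m)"

context lp_space
begin

lemma lp_bounded_by_diag_op:
  assumes "\<And>i. cmod (c i) \<le> B"
  shows "lp_bounded_by p (diag_op c) B"
  unfolding lp_bounded_by_def
proof
  have B_nonneg: "0 \<le> B"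
    using order_trans[OF norm_ge_zero assms] .
  fix x
  assume x_lp: "x \<in> lp p"
  have "lpnorm_on p {..<N} (diag_op c x) \<le> B * lpnorm p x" for N
  proof -
    have "lpnorm_on p {..<N} (diag_op c x) \<le> lpnorm_on p {..<N} (\<lambda>m. of_real B * x m)"
      using assms B_nonneg p_pos
      by (intro lpnorm_on_mono) (auto simp: diag_op_def norm_mult mult_right_mono)
    also have "\<dots> \<le> B * lpnorm p x"
      using B_nonneg p_pos lpnorm_on_le_lpnorm[OF x_lp, of "{..<N}"]
      by (simp add: lpnorm_on_scale mult_left_mono)
    finally show ?thesis .
  qed
  then show "diag_op c x \<in> lp p \<and> lpnorm p (diag_op c x) \<le> B * lpnorm p x"
    using lp_of_partial_sums by blast
qed

lemma diag_op_eigenvectors: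
  "\<exists>x. normalized_disjoint p x \<and> (\<forall>c n. diag_op c (x n) = seq_scale (c i) (x n))"
proof (intro exI conjI allI)
  define x :: "nat \<Rightarrow> seq" where "x n = (\<lambda>m. if m = prod_encode (i, n) then 1 else 0)" for n
  have supp: "seq_supp (x n) = {prod_encode (i, n)}" for n
    by (simp add: seq_supp_def x_def)
  have "lpnorm p (x n) = 1" "x n \<in> lp p" for n
    using lp_finite_support[of "{prod_encode (i, n)}" "x n"]
    by (auto simp: supp) (simp add: lpnorm_on_def x_def)
  then show "normalized_disjoint p x"
    by (auto simp: normalized_disjoint_def disjoint_family_on_def supp)
  show "diag_op c (x n) = seq_scale (c i) (x n)" for c n
    by (auto simp: diag_op_def seq_scale_def x_def)
qed

sublocale diag: linf_representation p diag_op 1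
proof
  fix c d :: "nat \<Rightarrow> complex" and a :: complex
  show "lp_linear p (diag_op c)"
    by (simp add: lp_linear_def diag_op_def seq_ops_defs algebra_simps)
  show "diag_op (\<lambda>i. c i + d i) = op_add (diag_op c) (diag_op d)"
    by (simp add: fun_eq_iff diag_op_def op_add_def seq_add_def distrib_right)
  show "diag_op (\<lambda>i. a * c i) = op_scale a (diag_op c)"
    by (simp add: fun_eq_iff diag_op_def op_scale_def seq_scale_def mult.assoc)
  show "diag_op (\<lambda>i. c i * d i) = diag_op c \<circ> diag_op d"
    by (simp add: fun_eq_iff diag_op_def mult.assoc)
  show "diag_op (\<lambda>i. 1) = id"
    by (simp add: fun_eq_iff diag_op_def)
  show "lp_bounded_by p (diag_op c) (1 * B)" if "\<And>i. cmod (c i) \<le> B" for B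
    using lp_bounded_by_diag_op[OF that] by simp
qed (simp, rule diag_op_eigenvectors)

end

section \<open>Rademacher multipliers\<close>

definition rademacher_part :: "(nat \<Rightarrow> complex) \<Rightarrow> bop" where
  "rademacher_part c x =
     (\<lambda>m. let n = floor_log m in rademacher_sum n (\<lambda>i. c i * rademacher_coeff n x i) m)"

text \<open>Multiplication by \<open>c i\<close> on the \<open>i\<close>-th Rademacher function of each block, and by \<open>c 0\<close> on the
  kernel of the Rademacher projection.\<close>

definition rademacher_op :: "(nat \<Rightarrow> complex) \<Rightarrow> bop" where
  "rademacher_op c = op_add (op_scale (c 0) id) (rademacher_part (\<lambda>i. c i - c 0))"

definition rademacher_seq :: "nat \<Rightarrow> (nat \<Rightarrow> complex) \<Rightarrow> seq" where
  "rademacher_seq n a = (\<lambda>m. if m \<in> block n then rademacher_sum n a m else 0)"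

definition rademacher_vec :: "real \<Rightarrow> nat \<Rightarrow> nat \<Rightarrow> seq" where
  "rademacher_vec p n i =
     rademacher_seq n (\<lambda>j. if j = i then complex_of_real (2 powr - (n / p)) else 0)"

definition rademacher_bound :: "real \<Rightarrow> real" where
  "rademacher_bound p = khintchine_const p * khintchine_const (p / (p - 1))"

lemma rademacher_coeff_add:
  "rademacher_coeff n (seq_add x y) i = rademacher_coeff n x i + rademacher_coeff n y i"
  by (simp add: rademacher_coeff_def seq_add_def sum.distrib distrib_right add_divide_distrib)

lemma rademacher_coeff_scale: "rademacher_coeff n (seq_scale c x) i = c * rademacher_coeff n x i"
  by (simp add: rademacher_coeff_def seq_scale_def mult.assoc flip: sum_distrib_left)

lemma rademacher_sum_cong:
  "(\<And>i. i < n \<Longrightarrow> a i = b i) \<Longrightarrow> rademacher_sum n a = rademacher_sum n b"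
  by (simp add: rademacher_sum_def)

lemma rademacher_sum_add:
  "rademacher_sum n (\<lambda>i. a i + b i) m = rademacher_sum n a m + rademacher_sum n b m"
  by (simp add: rademacher_sum_def distrib_right sum.distrib)

lemma rademacher_sum_scale: "rademacher_sum n (\<lambda>i. c * a i) m = c * rademacher_sum n a m"
  by (simp add: rademacher_sum_def mult.assoc flip: sum_distrib_left)

lemma rademacher_sum_sum:
  "rademacher_sum n (\<lambda>j. \<Sum>i\<in>F. a i j) m = (\<Sum>i\<in>F. rademacher_sum n (a i) m)"
  unfolding rademacher_sum_def by (subst sum.swap) (simp add: sum_distrib_right)

lemma rademacher_sum_single:
  assumes "i < n"
  shows "rademacher_sum n (\<lambda>j. if j = i then z else 0) m = z * rademacher i m"
proof -
  have "(\<Sum>j<n. (if j = i then z else 0) * rademacher j m) =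
      (\<Sum>j<n. if j = i then z * rademacher i m else 0)"
    by (rule sum.cong) auto
  then show ?thesis
    using assms by (simp add: rademacher_sum_def)
qed

lemma rademacher_part_add:
  "rademacher_part (\<lambda>i. c i + d i) = op_add (rademacher_part c) (rademacher_part d)"
  by (simp add: fun_eq_iff rademacher_part_def op_add_def seq_add_def Let_def distrib_right
      rademacher_sum_add)

lemma rademacher_part_scale: "rademacher_part (\<lambda>i. a * c i) = op_scale a (rademacher_part c)"
  by (simp add: fun_eq_iff rademacher_part_def op_scale_def seq_scale_def Let_def mult.assoc
      rademacher_sum_scale)

lemma rademacher_coeff_rademacher_part:
  assumes "i < n"
  shows "rademacher_coeff n (rademacher_part c x) i = c i * rademacher_coeff n x i"
proof -
  have "rademacher_coeff n (rademacher_part c x) i =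
      rademacher_coeff n (rademacher_sum n (\<lambda>i. c i * rademacher_coeff n x i)) i"
    by (rule rademacher_coeff_cong) (simp add: rademacher_part_def floor_log_block)
  then show ?thesis
    by (simp add: rademacher_coeff_rademacher_sum assms)
qed

lemma lp_linear_rademacher_part: "lp_linear p (rademacher_part c)"
  unfolding lp_linear_def
proof (intro conjI ballI allI)
  show "rademacher_part c (seq_add x y) = seq_add (rademacher_part c x) (rademacher_part c y)"
    for x y
    by (simp add: fun_eq_iff rademacher_part_def Let_def rademacher_coeff_add distrib_left
        rademacher_sum_add) (simp add: seq_add_def)
  show "rademacher_part c (seq_scale a x) = seq_scale a (rademacher_part c x)" for x a
    by (simp add: fun_eq_iff rademacher_part_def Let_def rademacher_coeff_scale
        mult.left_commute[of _ a] rademacher_sum_scale) (simp add: seq_scale_def)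
qed

lemma rademacher_op_add:
  "rademacher_op (\<lambda>i. c i + d i) = op_add (rademacher_op c) (rademacher_op d)"
proof -
  have "rademacher_part (\<lambda>i. c i + d i - (c 0 + d 0)) =
      op_add (rademacher_part (\<lambda>i. c i - c 0)) (rademacher_part (\<lambda>i. d i - d 0))"
    by (simp add: algebra_simps flip: rademacher_part_add)
  then show ?thesis
    by (simp add: rademacher_op_def fun_eq_iff op_add_def op_scale_def seq_ops_defs distrib_right)
qed

lemma rademacher_op_scale: "rademacher_op (\<lambda>i. a * c i) = op_scale a (rademacher_op c)"
proof -
  have "rademacher_part (\<lambda>i. a * c i - a * c 0) = op_scale a (rademacher_part (\<lambda>i. c i - c 0))"
    by (simp add: right_diff_distrib flip: rademacher_part_scale)
  then show ?thesis
    by (simp add: rademacher_op_def fun_eq_iff op_add_def op_scale_def seq_ops_defs distrib_left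
        mult.assoc)
qed

lemma rademacher_op_one: "rademacher_op (\<lambda>i. 1) = id"
  by (simp add: rademacher_op_def fun_eq_iff op_add_def op_scale_def seq_ops_defs
      rademacher_part_def rademacher_sum_def Let_def)

lemma rademacher_coeff_rademacher_op:
  "i < n \<Longrightarrow> rademacher_coeff n (rademacher_op c x) i = c i * rademacher_coeff n x i"
  by (simp add: rademacher_op_def op_add_def op_scale_def rademacher_coeff_add
      rademacher_coeff_scale rademacher_coeff_rademacher_part algebra_simps)

lemma rademacher_part_rademacher_op:
  "rademacher_part c (rademacher_op d x) = rademacher_part (\<lambda>i. c i * d i) x"
proof -
  have "rademacher_sum n (\<lambda>i. c i * rademacher_coeff n (rademacher_op d x) i) =
      rademacher_sum n (\<lambda>i. c i * d i * rademacher_coeff n x i)" for n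
    by (rule rademacher_sum_cong) (simp add: rademacher_coeff_rademacher_op)
  then show ?thesis
    by (simp add: rademacher_part_def Let_def)
qed

lemma rademacher_op_mult: "rademacher_op (\<lambda>i. c i * d i) = rademacher_op c \<circ> rademacher_op d"
proof
  fix x
  have "rademacher_part (\<lambda>i. c i * d i - c 0 * d 0) x =
      rademacher_part (\<lambda>i. (c i - c 0) * d i + c 0 * (d i - d 0)) x"
    by (simp add: algebra_simps)
  also have "\<dots> = seq_add (rademacher_part (\<lambda>i. c i - c 0) (rademacher_op d x))
      (seq_scale (c 0) (rademacher_part (\<lambda>i. d i - d 0) x))"
    by (simp add: rademacher_part_rademacher_op rademacher_part_add rademacher_part_scale
        op_add_def op_scale_def)
  finally show "rademacher_op (\<lambda>i. c i * d i) x = (rademacher_op c \<circ> rademacher_op d) x"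
    by (simp add: rademacher_op_def[of c] rademacher_op_def[of "\<lambda>i. c i * d i"])
      (simp add: rademacher_op_def[of d] op_add_def op_scale_def seq_ops_defs algebra_simps)
qed

lemma rademacher_coeff_rademacher_seq:
  "i < n \<Longrightarrow> rademacher_coeff n (rademacher_seq n a) i = a i"
  using rademacher_coeff_cong[of n "rademacher_seq n a" "rademacher_sum n a" i]
  by (simp add: rademacher_seq_def rademacher_coeff_rademacher_sum)

lemma seq_supp_rademacher_seq: "seq_supp (rademacher_seq n a) \<subseteq> block n"
  by (auto simp: seq_supp_def rademacher_seq_def)

lemma rademacher_part_rademacher_seq:
  "rademacher_part c (rademacher_seq n a) = rademacher_seq n (\<lambda>i. c i * a i)"
proof
  fix m
  show "rademacher_part c (rademacher_seq n a) m = rademacher_seq n (\<lambda>i. c i * a i) m"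
  proof (cases "m \<in> block n")
    case True
    have "rademacher_sum n (\<lambda>i. c i * rademacher_coeff n (rademacher_seq n a) i) =
        rademacher_sum n (\<lambda>i. c i * a i)"
      by (rule rademacher_sum_cong) (simp add: rademacher_coeff_rademacher_seq)
    then show ?thesis
      using True by (simp add: rademacher_part_def rademacher_seq_def floor_log_block)
  next
    case False
    have "rademacher_coeff k (rademacher_seq n a) i = 0" if "k = floor_log m" "i < k" for i k
    proof -
      have "0 < m"
        using that by (cases m) auto
      then have "m \<in> block k"
        using mem_block_floor_log that(1) by simp
      then have "block k \<inter> block n = {}"
        using False floor_log_block by blast
      then show ?thesis
        by (auto simp: rademacher_coeff_def rademacher_seq_def intro!: sum.neutral)
    qed
    then show ?thesis
      using False by (simp add: rademacher_part_def rademacher_seq_def rademacher_sum_def)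
  qed
qed

lemma rademacher_op_rademacher_seq:
  "rademacher_op c (rademacher_seq n a) = rademacher_seq n (\<lambda>i. c i * a i)"
proof -
  have "rademacher_sum n (\<lambda>i. c i * a i) m =
      c 0 * rademacher_sum n a m + rademacher_sum n (\<lambda>i. (c i - c 0) * a i) m" for m
    by (simp add: algebra_simps flip: rademacher_sum_scale rademacher_sum_add)
  then show ?thesis
    by (simp add: rademacher_op_def op_add_def op_scale_def rademacher_part_rademacher_seq)
      (auto simp: rademacher_seq_def seq_ops_defs)
qed

lemma rademacher_op_rademacher_vec:
  "rademacher_op c (rademacher_vec p n i) = seq_scale (c i) (rademacher_vec p n i)"
proof -
  have "rademacher_seq n (\<lambda>j. c j * (if j = i then s else 0)) =
      rademacher_seq n (\<lambda>j. c i * (if j = i then s else 0))" for s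
    by (rule arg_cong[of _ _ "rademacher_seq n"]) auto
  then show ?thesis
    by (simp add: rademacher_vec_def rademacher_op_rademacher_seq)
      (simp add: rademacher_seq_def seq_scale_def rademacher_sum_scale fun_eq_iff)
qed

lemma abs_rademacher: "\<bar>rademacher i m\<bar> = 1"
  by (simp add: rademacher_def)

context lp_space
begin

lemma rademacher_bound_nonneg: "0 \<le> rademacher_bound p"
  using khintchine_const_pos[of p] khintchine_const_pos[of "p / (p - 1)"] p_gt_1
  by (simp add: rademacher_bound_def)

lemma lp_of_blocks:
  assumes x_lp: "x \<in> lp p" and A_nonneg: "0 \<le> A" and zero: "y 0 = 0"
    and blocks: "\<And>n. lpnorm_on p (block n) y \<le> A * lpnorm_on p (block n) x"
  shows "y \<in> lp p" "lpnorm p y \<le> A * lpnorm p x"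
proof -
  have on_block: "(\<Sum>m\<in>block n. cmod (y m) powr p) \<le> A powr p * (\<Sum>m\<in>block n. cmod (x m) powr p)"
    for n
    using powr_mono2[OF _ lpnorm_on_nonneg blocks, of p n] A_nonneg p_pos
    by (simp add: powr_mult lpnorm_on_powr)
  have dyadic: "(\<Sum>m<2 ^ N. cmod (y m) powr p) \<le> A powr p * (\<Sum>m<(2::nat) ^ N. cmod (x m) powr p)"
    for N
  proof (induction N)
    case (Suc N)
    have "{..<2 ^ N} \<inter> block N = {}"
      by (auto simp: block_def)
    then show ?case
      unfolding lessThan_power2_Suc using Suc on_block[of N]
      by (simp add: sum.union_disjoint distrib_left)
  qed (simp add: zero)
  have "lpnorm_on p {..<N} y \<le> A * lpnorm p x" for N
  proof -
    have "(\<Sum>m<N. cmod (y m) powr p) \<le> (\<Sum>m<2 ^ N. cmod (y m) powr p)"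
      by (intro sum_mono2) (auto intro: less_trans[OF _ less_exp])
    also have "\<dots> \<le> A powr p * lpnorm_on p {..<2 ^ N} x powr p"
      using dyadic by (simp add: lpnorm_on_powr p_pos)
    also have "\<dots> \<le> A powr p * lpnorm p x powr p"
      using p_pos by (intro mult_left_mono powr_mono2 lpnorm_on_le_lpnorm x_lp) auto
    finally have "lpnorm_on p {..<N} y powr p \<le> (A * lpnorm p x) powr p"
      using A_nonneg by (simp add: powr_mult lpnorm_on_powr p_pos)
    then show ?thesis
      using A_nonneg by (simp add: powr_le_powr_iff p_pos)
  qed
  then show "y \<in> lp p" "lpnorm p y \<le> A * lpnorm p x"
    using lp_of_partial_sums by auto
qed

lemma lp_bounded_by_rademacher_part:
  assumes "\<And>i. cmod (c i) \<le> B"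
  shows "lp_bounded_by p (rademacher_part c) (rademacher_bound p * B)"
  unfolding lp_bounded_by_def
proof (intro ballI conjI)
  have "0 \<le> B"
    using order_trans[OF norm_ge_zero assms] .
  then have nonneg: "0 \<le> rademacher_bound p * B"
    using rademacher_bound_nonneg by simp
  have zero: "rademacher_part c x 0 = 0" for x
    by (simp add: rademacher_part_def rademacher_sum_def)
  have blocks: "lpnorm_on p (block n) (rademacher_part c x) \<le>
      rademacher_bound p * B * lpnorm_on p (block n) x" for n x
  proof -
    have "lpnorm_on p (block n) (rademacher_part c x) =
        lpnorm_on p (block n) (rademacher_sum n (\<lambda>i. c i * rademacher_coeff n x i))"
      by (rule lpnorm_on_cong) (simp add: rademacher_part_def floor_log_block)
    also have "\<dots> \<le> rademacher_bound p * B * lpnorm_on p (block n) x"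
      unfolding rademacher_bound_def
      by (rule lpnorm_on_rademacher_multiplier_le[OF conjugate_exponents_divide[OF p_gt_1] assms])
    finally show ?thesis .
  qed
  fix x
  assume "x \<in> lp p"
  note lp_of_blocks[OF this nonneg zero blocks]
  then show "rademacher_part c x \<in> lp p"
    "lpnorm p (rademacher_part c x) \<le> rademacher_bound p * B * lpnorm p x"
    by auto
qed

lemma lp_bounded_by_mono: "lp_bounded_by p T A \<Longrightarrow> A \<le> B \<Longrightarrow> lp_bounded_by p T B"
  unfolding lp_bounded_by_def by (meson lpnorm_nonneg mult_right_mono order_trans)

lemma lp_bounded_by_rademacher_op:
  assumes "\<And>i. cmod (c i) \<le> B"
  shows "lp_bounded_by p (rademacher_op c) ((1 + 2 * rademacher_bound p) * B)"
proof -
  have "cmod (c i - c 0) \<le> 2 * B" for i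
    using norm_triangle_ineq4[of "c i" "c 0"] assms[of i] assms[of 0] by linarith
  then have "lp_bounded_by p (rademacher_part (\<lambda>i. c i - c 0)) (rademacher_bound p * (2 * B))"
    by (rule lp_bounded_by_rademacher_part)
  moreover have "lp_bounded_by p id 1"
    by (simp add: lp_bounded_by_def)
  ultimately have
    "lp_bounded_by p (rademacher_op c) (cmod (c 0) * 1 + rademacher_bound p * (2 * B))"
    unfolding rademacher_op_def by (intro lp_bounded_by_add lp_bounded_by_scale)
  then show ?thesis
    by (rule lp_bounded_by_mono) (use assms[of 0] in \<open>simp add: algebra_simps\<close>)
qed

lemma lp_rademacher_seq:
  "rademacher_seq n a \<in> lp p"
  "lpnorm p (rademacher_seq n a) = lpnorm_on p (block n) (rademacher_sum n a)"
  using lp_finite_support[OF finite_block seq_supp_rademacher_seq]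
    lpnorm_on_cong[of "block n" "rademacher_seq n a" "rademacher_sum n a"]
  by (auto simp: rademacher_seq_def)

lemma normalized_disjoint_rademacher_vec:
  assumes "i < k"
  shows "normalized_disjoint p (\<lambda>n. rademacher_vec p (k + n) i)"
  unfolding normalized_disjoint_def
proof (intro conjI allI)
  fix n
  show "rademacher_vec p (k + n) i \<in> lp p"
    by (simp add: rademacher_vec_def lp_rademacher_seq)
  have "lpnorm p (rademacher_vec p (k + n) i) =
      lpnorm_on p (block (k + n)) (\<lambda>m. 2 powr - ((k + n) / p) :: real)"
    using assms unfolding rademacher_vec_def lp_rademacher_seq lpnorm_on_def
    by (simp add: rademacher_sum_single norm_mult abs_rademacher)
  also have "\<dots> = 1"
    using p_pos by (simp add: lpnorm_on_const powr_powr powr_minus flip: powr_realpow)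
  finally show "lpnorm p (rademacher_vec p (k + n) i) = 1" .
next
  have "seq_supp (rademacher_vec p (k + n) i) \<subseteq> block (k + n)" for n
    by (simp add: rademacher_vec_def seq_supp_rademacher_seq)
  moreover have "block (k + m) \<inter> block (k + n) = {}" if "m \<noteq> n" for m n
    using that by (auto dest!: floor_log_block)
  ultimately show "disjoint_family (\<lambda>n. seq_supp (rademacher_vec p (k + n) i))"
    unfolding disjoint_family_on_def by blast
qed

sublocale rademacher: linf_representation p rademacher_op "1 + 2 * rademacher_bound p"
proof
  fix c :: "nat \<Rightarrow> complex"
  show "lp_linear p (rademacher_op c)"
    unfolding rademacher_op_def
    by (intro lp_linear_add lp_linear_scale lp_linear_rademacher_part) (simp add: lp_linear_def)
  show "\<exists>x. normalized_disjoint p x \<and> (\<forall>c n. rademacher_op c (x n) = seq_scale (c i) (x n))" for i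
    using normalized_disjoint_rademacher_vec[of i "Suc i"] rademacher_op_rademacher_vec by blast
qed (auto intro: rademacher_op_add rademacher_op_scale rademacher_op_mult rademacher_op_one
    lp_bounded_by_rademacher_op simp: rademacher_bound_nonneg)

lemma seq_sum_rademacher_vec:
  "seq_sum (rademacher_vec p n) {..<N} =
      rademacher_seq n (\<lambda>j. if j < N then complex_of_real (2 powr - (n / p)) else 0)"
proof
  fix m
  have "rademacher_sum n (\<lambda>j. if j < N then z else 0) m =
      (\<Sum>i<N. rademacher_sum n (\<lambda>j. if j = i then z else 0) m)" for z
    by (simp flip: rademacher_sum_sum)
  then show "seq_sum (rademacher_vec p n) {..<N} m =
      rademacher_seq n (\<lambda>j. if j < N then complex_of_real (2 powr - (n / p)) else 0) m"
    by (simp add: seq_sum_def rademacher_vec_def rademacher_seq_def)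
qed

lemma lpnorm_seq_sum_rademacher_vec:
  fixes n N :: nat
  assumes "N \<le> n"
  defines "S \<equiv> lpnorm p (seq_sum (rademacher_vec p n) {..<N})"
  shows "S \<le> khintchine_const p * N powr (1 / 2)"
    and "N powr (1 / 2) \<le> khintchine_const (p / (p - 1)) * S"
proof -
  define a :: "nat \<Rightarrow> complex"
    where "a = (\<lambda>j. if j < N then complex_of_real (2 powr - (n / p)) else 0)"
  have S_eq: "S = lpnorm_on p (block n) (rademacher_sum n a)"
    by (simp add: S_def a_def seq_sum_rademacher_vec lp_rademacher_seq)
  have "(\<Sum>j<n. cmod (a j) powr 2) = (\<Sum>j<N. cmod (a j) powr 2)"
    by (rule sum.mono_neutral_right) (use assms in \<open>auto simp: a_def\<close>)
  then have "lpnorm_on 2 {..<n} a = lpnorm_on 2 {..<N} (\<lambda>j. 2 powr - (n / p) :: real)"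
    by (simp add: lpnorm_on_def a_def)
  then have norm_a: "2 powr (n / p) * lpnorm_on 2 {..<n} a = N powr (1 / 2)"
    by (simp add: lpnorm_on_const flip: powr_add)
  show "S \<le> khintchine_const p * N powr (1 / 2)"
    using khintchine[OF p_pos, of n a] unfolding S_eq mult.assoc norm_a .
  show "N powr (1 / 2) \<le> khintchine_const (p / (p - 1)) * S"
    using lpnorm_on_rademacher_sum_ge[OF conjugate_exponents_divide[OF p_gt_1], of n a]
    unfolding S_eq norm_a .
qed

end

section \<open>Intertwiners modulo compact operators\<close>

definition bounded_below :: "real \<Rightarrow> bop \<Rightarrow> bool" where
  "bounded_below p V \<longleftrightarrow> (\<exists>c>0. \<forall>x\<in>lp p. c * lpnorm p x \<le> lpnorm p (V x))"

definition intertwiner ::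
  "real \<Rightarrow> ((real \<Rightarrow> complex) \<Rightarrow> bop) \<Rightarrow> ((real \<Rightarrow> complex) \<Rightarrow> bop) \<Rightarrow> bop \<Rightarrow> bool" where
  "intertwiner p \<rho>1 \<rho>2 V \<longleftrightarrow> bounded_op p V \<and> bounded_below p V \<and>
     (\<forall>f\<in>C01. essentially_eq p (V \<circ> \<rho>2 f) (\<rho>1 f \<circ> V))"

context lp_space
begin

lemma essentially_intertwines_of_similarity:
  assumes bounded: "bounded_op p S" "bounded_op p R" "bounded_op p A" "bounded_op p B"
    "bounded_op p W"
    and inverse: "op_eq p (R \<circ> S) id"
    and similar: "essentially_eq p (S \<circ> A \<circ> R) D"
    and intertwines: "essentially_eq p (W \<circ> B) (D \<circ> W)"
  shows "essentially_eq p (R \<circ> W \<circ> B) (A \<circ> (R \<circ> W))"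
proof -
  note comp = bounded_op_comp
  have bounded_D: "bounded_op p D"
    by (rule bounded_op_essentially_eq[OF similar comp[OF comp[OF bounded(1,3)] bounded(2)]])
  have "essentially_eq p (R \<circ> (W \<circ> B)) (R \<circ> (D \<circ> W))"
    by (rule essentially_eq_comp_left[OF intertwines comp[OF bounded(5,4)] bounded(2)])
  also have "essentially_eq p (R \<circ> (D \<circ> W)) (R \<circ> (S \<circ> A \<circ> R \<circ> W))"
    by (intro essentially_eq_comp_left essentially_eq_comp_right essentially_eq_sym[OF similar] comp
        bounded_D bounded)
  also have "essentially_eq p (R \<circ> (S \<circ> A \<circ> R \<circ> W)) (A \<circ> (R \<circ> W))"
    using inverse bounded[THEN bounded_opD(1)] by (intro essentially_eq_of_eq) (simp add: op_eq_def)
  finally show ?thesis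
    by (simp add: comp_assoc)
qed

lemma bounded_below_of_left_inverse:
  assumes "bounded_op p S" "bounded_op p V" "\<And>x. x \<in> lp p \<Longrightarrow> lpnorm p (S (V x)) = lpnorm p x"
  shows "bounded_below p V"
proof -
  obtain B where B_pos: "0 < B" and S_bound: "lp_bounded_by p S B"
    using assms(1) by (rule bounded_opE)
  have "1 / B * lpnorm p x \<le> lpnorm p (V x)" if "x \<in> lp p" for x
    using lp_bounded_byD(2)[OF S_bound bounded_opD(1)[OF assms(2) that]] assms(3)[OF that] B_pos
    by (simp add: field_simps)
  then show ?thesis
    unfolding bounded_below_def using B_pos by (intro exI[of _ "1 / B"]) simp
qed

lemma ext_equiv_imp_intertwiner_of_isometry:
  assumes bounded: "\<And>f. f \<in> C01 \<Longrightarrow> bounded_op p (\<rho>1 f)" "\<And>f. f \<in> C01 \<Longrightarrow> bounded_op p (\<rho>2 f)"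
    and equiv: "ext_equiv p (\<lambda>f. calkin_pi p (\<rho>1 f)) (\<lambda>f. calkin_pi p (D f))"
    and W_op: "bounded_op p W" and W_isometry: "\<And>x. x \<in> lp p \<Longrightarrow> lpnorm p (W x) = lpnorm p x"
    and W_intertwines: "\<And>f. f \<in> C01 \<Longrightarrow> essentially_eq p (W \<circ> \<rho>2 f) (D f \<circ> W)"
  shows "\<exists>V. intertwiner p \<rho>1 \<rho>2 V"
proof -
  obtain S R where S_op: "bounded_op p S" and R_op: "bounded_op p R"
    and inverse: "op_eq p (S \<circ> R) id" "op_eq p (R \<circ> S) id"
    and D_eq: "\<And>f. f \<in> C01 \<Longrightarrow> calkin_pi p (D f) = calkin_pi p (S \<circ> rep (calkin_pi p (\<rho>1 f)) \<circ> R)"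
    using equiv unfolding ext_equiv_def by blast
  have "essentially_eq p (R \<circ> W \<circ> \<rho>2 f) (\<rho>1 f \<circ> (R \<circ> W))" if f_C01: "f \<in> C01" for f
  proof -
    define A where "A = rep (calkin_pi p (\<rho>1 f))"
    have A_op: "bounded_op p A" and A_eq: "essentially_eq p A (\<rho>1 f)"
      using rep_calkin_pi[OF bounded(1)[OF f_C01]] by (auto simp: A_def)
    have "bounded_op p (S \<circ> A \<circ> R)"
      by (intro bounded_op_comp S_op R_op A_op A_eq)
    then have "essentially_eq p (S \<circ> A \<circ> R) (D f)"
      using D_eq[OF f_C01] by (simp add: A_def flip: calkin_pi_eq_iff)
    then have "essentially_eq p (R \<circ> W \<circ> \<rho>2 f) (A \<circ> (R \<circ> W))"
      by (rule essentially_intertwines_of_similarity[OF S_op R_op A_op bounded(2)[OF f_C01]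
            W_op inverse(2) _ W_intertwines[OF f_C01]])
    also have "essentially_eq p (A \<circ> (R \<circ> W)) (\<rho>1 f \<circ> (R \<circ> W))"
      by (intro essentially_eq_comp_right A_eq bounded_op_comp R_op W_op)
    finally show ?thesis .
  qed
  moreover have "bounded_op p (R \<circ> W)"
    by (rule bounded_op_comp[OF R_op W_op])
  moreover have "bounded_below p (R \<circ> W)"
  proof (rule bounded_below_of_left_inverse[OF S_op calculation(2)])
    show "lpnorm p (S ((R \<circ> W) x)) = lpnorm p x" if "x \<in> lp p" for x
      using inverse(1) W_isometry[OF that] bounded_opD(1)[OF W_op that] by (simp add: op_eq_def)
  qed
  ultimately show ?thesis
    unfolding intertwiner_def by blast
qed

lemma ext_equiv_imp_intertwiner:
  assumes "\<And>f. f \<in> C01 \<Longrightarrow> bounded_op p (\<rho>1 f)" "\<And>f. f \<in> C01 \<Longrightarrow> bounded_op p (\<rho>2 f)"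
    and "ext_equiv p (\<lambda>f. calkin_pi p (\<rho>1 f)) (\<lambda>f. calkin_pi p (\<rho>2 f))"
  shows "\<exists>V. intertwiner p \<rho>1 \<rho>2 V"
  by (rule ext_equiv_imp_intertwiner_of_isometry[OF assms bounded_op_id])
    (simp_all add: essentially_eq_of_eq)

lemma interleave_zero:
  assumes "u \<in> lp p"
  shows "interleave u (\<lambda>n. 0) \<in> lp p" "lpnorm p (interleave u (\<lambda>n. 0)) = lpnorm p u"
proof -
  let ?v = "\<lambda>n. cmod (interleave u (\<lambda>n. 0) n) powr p"
  have mono: "strict_mono (\<lambda>n::nat. 2 * n)"
    by (simp add: strict_mono_def)
  have zero: "?v n = 0" if "n \<notin> range (\<lambda>n. 2 * n)" for n
    using that by (auto simp: interleave_def elim!: evenE)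
  have even_terms: "(\<lambda>n. ?v (2 * n)) = (\<lambda>n. cmod (u n) powr p)"
    by (simp add: interleave_def)
  show "interleave u (\<lambda>n. 0) \<in> lp p"
    using summable_mono_reindex[of "\<lambda>n. 2 * n" ?v, OF mono zero] assms
    unfolding even_terms lp_def by simp
  show "lpnorm p (interleave u (\<lambda>n. 0)) = lpnorm p u"
    using suminf_mono_reindex[of "\<lambda>n. 2 * n" ?v, OF mono zero]
    unfolding even_terms lpnorm_def by simp
qed

lemma bounded_op_interleave_zero: "bounded_op p (\<lambda>u. interleave u (\<lambda>n. 0))"
proof (rule bounded_opI)
  show "lp_linear p (\<lambda>u. interleave u (\<lambda>n. 0))"
    by (auto simp: lp_linear_def interleave_def seq_ops_defs)
  show "lp_bounded_by p (\<lambda>u. interleave u (\<lambda>n. 0)) 1"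
    by (simp add: lp_bounded_by_def interleave_zero)
qed

lemma ext_equiv_sum_imp_intertwiner:
  assumes bounded: "\<And>f. f \<in> C01 \<Longrightarrow> bounded_op p (\<rho>1 f)" "\<And>f. f \<in> C01 \<Longrightarrow> bounded_op p (\<rho>2 f)"
    and \<phi>: "iso_ext p \<phi>"
    and equiv: "ext_equiv p (\<lambda>f. calkin_pi p (\<rho>1 f)) (ext_sum p (\<lambda>f. calkin_pi p (\<rho>2 f)) \<phi>)"
  shows "\<exists>V. intertwiner p \<rho>1 \<rho>2 V"
proof (rule ext_equiv_imp_intertwiner_of_isometry[OF bounded equiv[unfolded ext_sum_def]
    bounded_op_interleave_zero interleave_zero(2)])
  let ?W = "\<lambda>u. interleave u (\<lambda>n. 0)"
  fix f
  assume f_C01: "f \<in> C01"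
  note rep = rep_calkin_pi[OF bounded(2)[OF f_C01]]
  obtain T where "bounded_op p T" "\<phi> f = calkin_pi p T"
    using \<phi> f_C01 by (auto simp: iso_ext_def calkin_def)
  then have "bounded_op p (rep (\<phi> f))"
    using rep_calkin_pi(1) by simp
  then have zero: "rep (\<phi> f) (\<lambda>n. 0) = (\<lambda>n. 0)"
    by (rule bounded_op_zero_arg)
  have "evens (?W x) = x" "odds (?W x) = (\<lambda>n. 0)" for x
    by (auto simp: evens_def odds_def interleave_def)
  then have dsum_interleave:
    "op_dsum (rep (calkin_pi p (\<rho>2 f))) (rep (\<phi> f)) \<circ> ?W = ?W \<circ> rep (calkin_pi p (\<rho>2 f))"
    by (simp add: op_dsum_def zero o_def)
  show "essentially_eq p (?W \<circ> \<rho>2 f) (op_dsum (rep (calkin_pi p (\<rho>2 f))) (rep (\<phi> f)) \<circ> ?W)"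
    unfolding dsum_interleave
    by (rule essentially_eq_comp_left[OF essentially_eq_sym[OF rep(2)] bounded(2)[OF f_C01]
          bounded_op_interleave_zero])
qed

end

section \<open>The exponents of nearly disjoint images\<close>

definition eigensequence ::
  "real \<Rightarrow> ((real \<Rightarrow> complex) \<Rightarrow> bop) \<Rightarrow> real \<Rightarrow> (nat \<Rightarrow> seq) \<Rightarrow> bool" where
  "eigensequence p \<rho> s x \<longleftrightarrow>
     normalized_disjoint p x \<and> (\<forall>f\<in>C01. \<forall>n. \<rho> f (x n) = seq_scale (f s) (x n))"

lemma ex_disjoint_bumps:
  fixes t :: "nat \<Rightarrow> real"
  assumes "inj t"
  shows "\<exists>f. \<forall>j<N. f j \<in> C01 \<and> f j (t j) = 1 \<and> (\<forall>k<N. j \<noteq> k \<longrightarrow> (\<forall>s. f j s = 0 \<or> f k s = 0))"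
proof -
  have "uniform_discrete (t ` {..<N})"
    using uniform_discrete_finite_iff[of "t ` {..<N}"] by simp
  then obtain d where d_pos: "0 < d" and "\<And>j k. j < N \<Longrightarrow> k < N \<Longrightarrow> dist (t j) (t k) < d \<Longrightarrow> t j = t k"
    unfolding uniform_discrete_def by auto
  then have separated: "d \<le> dist (t j) (t k)" if "j < N" "k < N" "j \<noteq> k" for j k
    using that assms by (metis injD not_le)
  define f :: "nat \<Rightarrow> real \<Rightarrow> complex"
    where "f j s = of_real (max 0 (1 - 2 * dist (t j) s / d))" for j s
  have "f j \<in> C01" "f j (t j) = 1" for j
    using d_pos by (auto simp: C01_def f_def intro!: continuous_intros)
  moreover have "f j s = 0 \<or> f k s = 0" if distinct: "j < N" "k < N" "j \<noteq> k" for j k s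
  proof -
    have "d / 2 \<le> dist (t j) s \<or> d / 2 \<le> dist (t k) s"
      using separated[OF distinct] dist_triangle2[of "t j" "t k" s] by linarith
    then show ?thesis
      using d_pos by (auto simp: f_def field_simps)
  qed
  ultimately show ?thesis
    by blast
qed

context lp_space
begin

lemma lpnorm_seq_sum_diff_le:
  fixes e :: real
  assumes "finite F" "\<And>i. i \<in> F \<Longrightarrow> y i \<in> lp p" "\<And>i. i \<in> F \<Longrightarrow> z i \<in> lp p"
    and "\<And>i. i \<in> F \<Longrightarrow> lpnorm p (seq_diff (y i) (z i)) \<le> e"
  shows "lpnorm p (seq_diff (seq_sum y F) (seq_sum z F)) \<le> card F * e"
proof -
  have "seq_diff (seq_sum y F) (seq_sum z F) = seq_sum (\<lambda>i. seq_diff (y i) (z i)) F"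
    by (simp add: fun_eq_iff seq_sum_def seq_diff_def sum_subtractf)
  then have "lpnorm p (seq_diff (seq_sum y F) (seq_sum z F)) \<le>
      (\<Sum>i\<in>F. lpnorm p (seq_diff (y i) (z i)))"
    using assms by (simp add: lpnorm_seq_sum_le lp_diff)
  also have "\<dots> \<le> card F * e"
    using assms(4) by (rule sum_bounded_above)
  finally show ?thesis .
qed

lemma lpnorm_seq_sum_nearly_disjoint_ge:
  fixes e :: real
  assumes "finite F" and y_lp: "\<And>i. i \<in> F \<Longrightarrow> y i \<in> lp p" and z_lp: "\<And>i. i \<in> F \<Longrightarrow> z i \<in> lp p"
    and disj: "disjoint_family_on (\<lambda>i. seq_supp (z i)) F"
    and close: "\<And>i. i \<in> F \<Longrightarrow> lpnorm p (seq_diff (y i) (z i)) \<le> e"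
    and "e \<le> a" and y_ge: "\<And>i. i \<in> F \<Longrightarrow> a \<le> lpnorm p (y i)"
  shows "(a - e) * card F powr (1 / p) - card F * e \<le> lpnorm p (seq_sum y F)"
proof -
  have "a - e \<le> lpnorm p (z i)" if "i \<in> F" for i
    using y_ge[OF that] close[OF that] lpnorm_le_add_diff[OF y_lp[OF that] z_lp[OF that]]
    by linarith
  then have "(a - e) * card F powr (1 / p) \<le> lpnorm p (seq_sum z F)"
    using assms(1,6) z_lp disj by (intro lpnorm_seq_sum_disjoint_ge) auto
  moreover have "lpnorm p (seq_diff (seq_sum z F) (seq_sum y F)) \<le> card F * e"
    using assms(1) z_lp y_lp close lpnorm_diff_commute[OF y_lp z_lp]
    by (intro lpnorm_seq_sum_diff_le) auto
  moreover have "lpnorm p (seq_sum z F) \<le>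
      lpnorm p (seq_sum y F) + lpnorm p (seq_diff (seq_sum z F) (seq_sum y F))"
    by (intro lpnorm_le_add_diff lp_seq_sum assms(1) z_lp y_lp)
  ultimately show ?thesis
    by linarith
qed

lemma lpnorm_seq_sum_nearly_disjoint_le:
  fixes e :: real
  assumes "finite F" and y_lp: "\<And>i. i \<in> F \<Longrightarrow> y i \<in> lp p" and z_lp: "\<And>i. i \<in> F \<Longrightarrow> z i \<in> lp p"
    and disj: "disjoint_family_on (\<lambda>i. seq_supp (z i)) F"
    and close: "\<And>i. i \<in> F \<Longrightarrow> lpnorm p (seq_diff (y i) (z i)) \<le> e"
    and "0 \<le> b + e" and y_le: "\<And>i. i \<in> F \<Longrightarrow> lpnorm p (y i) \<le> b"
  shows "lpnorm p (seq_sum y F) \<le> (b + e) * card F powr (1 / p) + card F * e"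
proof -
  have "lpnorm p (z i) \<le> b + e" if "i \<in> F" for i
    using y_le[OF that] close[OF that] lpnorm_le_add_diff[OF z_lp[OF that] y_lp[OF that]]
      lpnorm_diff_commute[OF y_lp[OF that] z_lp[OF that]] by linarith
  then have "lpnorm p (seq_sum z F) \<le> (b + e) * card F powr (1 / p)"
    using assms(1,6) z_lp disj by (intro lpnorm_seq_sum_disjoint_le) auto
  moreover have "lpnorm p (seq_diff (seq_sum y F) (seq_sum z F)) \<le> card F * e"
    by (rule lpnorm_seq_sum_diff_le[OF assms(1) y_lp z_lp close])
  moreover have "lpnorm p (seq_sum y F) \<le>
      lpnorm p (seq_sum z F) + lpnorm p (seq_diff (seq_sum y F) (seq_sum z F))"
    by (intro lpnorm_le_add_diff lp_seq_sum assms(1) z_lp y_lp)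
  ultimately show ?thesis
    by linarith
qed

lemma lpnorm_seq_sum_nearly_disjoint:
  fixes e :: real
  assumes "finite F" "F \<noteq> {}" and y_lp: "\<And>i. i \<in> F \<Longrightarrow> y i \<in> lp p"
    and z_lp: "\<And>i. i \<in> F \<Longrightarrow> z i \<in> lp p" and disj: "disjoint_family_on (\<lambda>i. seq_supp (z i)) F"
    and close: "\<And>i. i \<in> F \<Longrightarrow> lpnorm p (seq_diff (y i) (z i)) \<le> e"
    and "0 < e" "0 \<le> b" and card_e: "card F * e \<le> a / 4"
    and y_ge: "\<And>i. i \<in> F \<Longrightarrow> a \<le> lpnorm p (y i)"
    and y_le: "\<And>i. i \<in> F \<Longrightarrow> lpnorm p (y i) \<le> b"
  shows "a / 2 * card F powr (1 / p) \<le> lpnorm p (seq_sum y F)"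
    and "lpnorm p (seq_sum y F) \<le> (b + a) * card F powr (1 / p)"
proof -
  define m where "m = card F powr (1 / p)"
  have card_ge_1: "1 \<le> real (card F)"
    using assms(1,2) by (simp add: Suc_leI card_gt_0_iff)
  then have m_ge_1: "1 \<le> m"
    using p_pos by (simp add: m_def ge_one_powr_ge_zero)
  have e_le: "e \<le> a / 4"
    using order_trans[OF mult_right_mono[OF card_ge_1] card_e] \<open>0 < e\<close> by simp
  then have "0 \<le> a * m"
    using \<open>0 < e\<close> m_ge_1 by simp
  have "a / 4 * 1 \<le> a / 4 * m"
    using m_ge_1 e_le \<open>0 < e\<close> by (intro mult_left_mono) auto
  then have errors: "e * m \<le> a / 4 * m" "card F * e \<le> a / 4 * m"
    using mult_right_mono[OF e_le, of m] m_ge_1 card_e by linarith+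
  have "(a - e) * m - card F * e \<le> lpnorm p (seq_sum y F)"
    unfolding m_def using \<open>0 < e\<close> e_le assms(1)
    by (intro lpnorm_seq_sum_nearly_disjoint_ge[OF _ y_lp z_lp disj close _ y_ge]) auto
  then show "a / 2 * card F powr (1 / p) \<le> lpnorm p (seq_sum y F)"
    unfolding m_def[symmetric] left_diff_distrib using errors by linarith
  have "lpnorm p (seq_sum y F) \<le> (b + e) * m + card F * e"
    unfolding m_def using \<open>0 < e\<close> \<open>0 \<le> b\<close> assms(1)
    by (intro lpnorm_seq_sum_nearly_disjoint_le[OF _ y_lp z_lp disj close _ y_le]) auto
  then show "lpnorm p (seq_sum y F) \<le> (b + a) * card F powr (1 / p)"
    unfolding m_def[symmetric] distrib_right using errors \<open>0 \<le> a * m\<close> by linarith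
qed

lemma intertwiner_diag_nearly_disjoint:
  assumes intertwines: "intertwiner p (\<lambda>f. diag_op (f \<circ> t)) \<rho> V" and dense: "dense_points t"
    and t_inj: "inj t"
    and eigensequences: "\<And>j. j < N \<Longrightarrow> eigensequence p \<rho> (t j) (x j)"
    and "0 < e"
  shows "\<exists>n z. disjoint_family_on (\<lambda>j. seq_supp (z j)) {..<N} \<and>
    (\<forall>j<N. z j \<in> lp p \<and> lpnorm p (seq_diff (V (x j n)) (z j)) < e)"
proof -
  have normalized: "normalized_disjoint p (x j)"
    and eigen: "f \<in> C01 \<Longrightarrow> \<rho> f (x j n) = seq_scale (f (t j)) (x j n)" if "j < N" for j f n
    using eigensequences[OF that] by (auto simp: eigensequence_def)
  obtain f where f_C01: "\<And>j. j < N \<Longrightarrow> f j \<in> C01" and f_peak: "\<And>j. j < N \<Longrightarrow> f j (t j) = 1"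
    and f_disjoint: "\<And>j k s. j < N \<Longrightarrow> k < N \<Longrightarrow> j \<noteq> k \<Longrightarrow> f j s = 0 \<or> f k s = 0"
    using ex_disjoint_bumps[OF t_inj, of N] by metis
  define z where "z n j = diag_op (f j \<circ> t) (V (x j n))" for n j
  have lim: "(\<lambda>n. lpnorm p (seq_diff (V (x j n)) (z n j))) \<longlonglongrightarrow> 0" if j_less: "j < N" for j
  proof -
    have "compact_op p (\<lambda>x. seq_diff (V (\<rho> (f j) x)) (diag_op (f j \<circ> t) (V x)))"
      using intertwines f_C01[OF j_less] by (simp add: intertwiner_def essentially_eq_def)
    from compact_op_normalized_disjoint_tendsto_0[OF this normalized[OF j_less]] show ?thesis
      using eigen[OF j_less f_C01[OF j_less]] f_peak[OF j_less] by (simp add: z_def seq_scale_def)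
  qed
  have "\<forall>\<^sub>F n in sequentially. \<forall>j\<in>{..<N}. lpnorm p (seq_diff (V (x j n)) (z n j)) < e"
    using \<open>0 < e\<close> by (intro eventually_ball_finite ballI order_tendstoD(2)[OF lim]) auto
  then obtain n where "\<forall>j\<in>{..<N}. lpnorm p (seq_diff (V (x j n)) (z n j)) < e"
    using eventually_happens'[OF sequentially_bot] by blast
  moreover have "z n j \<in> lp p" if j_less: "j < N" for j
  proof -
    have "x j n \<in> lp p"
      using normalized[OF j_less] by (simp add: normalized_disjoint_def)
    then show ?thesis
      using intertwines diag.bounded_op_sample[OF dense f_C01[OF j_less]]
      by (simp add: z_def intertwiner_def bounded_opD)
  qed
  moreover have "disjoint_family_on (\<lambda>j. seq_supp (z n j)) {..<N}"
    using f_disjoint by (fastforce simp: disjoint_family_on_def seq_supp_def z_def diag_op_def)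
  ultimately show ?thesis
    by blast
qed

lemma intertwiner_diag_sum_bounds:
  fixes N :: nat
  assumes intertwines: "intertwiner p (\<lambda>f. diag_op (f \<circ> t)) \<rho> V" and dense: "dense_points t"
    and t_inj: "inj t"
    and eigensequences: "\<And>j. j < N \<Longrightarrow> eigensequence p \<rho> (t j) (x j)"
    and "0 < N" "0 < a" and V_ge: "\<And>u. u \<in> lp p \<Longrightarrow> a * lpnorm p u \<le> lpnorm p (V u)"
    and "0 < b" and V_le: "lp_bounded_by p V b"
  shows "\<exists>n. a / 2 * N powr (1 / p) \<le> lpnorm p (V (seq_sum (\<lambda>j. x j n) {..<N})) \<and>
    lpnorm p (V (seq_sum (\<lambda>j. x j n) {..<N})) \<le> (b + a) * N powr (1 / p)"
proof -
  have bounded_V: "bounded_op p V"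
    using intertwines by (simp add: intertwiner_def)
  define e where "e = a / (4 * N)"
  have e_pos: "0 < e" and N_e: "N * e = a / 4"
    using \<open>0 < a\<close> \<open>0 < N\<close> by (auto simp: e_def field_simps)
  obtain n z where disj: "disjoint_family_on (\<lambda>j. seq_supp (z j)) {..<N}"
    and z_lp: "\<And>j. j < N \<Longrightarrow> z j \<in> lp p"
    and close: "\<And>j. j < N \<Longrightarrow> lpnorm p (seq_diff (V (x j n)) (z j)) < e"
    using intertwiner_diag_nearly_disjoint[OF intertwines dense t_inj eigensequences e_pos]
    by blast
  have x_lp: "x j n \<in> lp p" and x_norm: "lpnorm p (x j n) = 1" if "j < N" for j
    using eigensequences[OF that] by (auto simp: eigensequence_def normalized_disjoint_def)
  have Vx_lp: "V (x j n) \<in> lp p" and Vx_ge: "a \<le> lpnorm p (V (x j n))"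
    and Vx_le: "lpnorm p (V (x j n)) \<le> b" if "j < N" for j
    using bounded_opD(1)[OF bounded_V x_lp] V_ge[OF x_lp] lp_bounded_byD(2)[OF V_le x_lp] that
    by (simp_all add: x_norm)
  have "V (seq_sum (\<lambda>j. x j n) {..<N}) = seq_sum (\<lambda>j. V (x j n)) {..<N}"
    using x_lp by (intro bounded_op_seq_sum_arg[OF bounded_V]) auto
  moreover have "a / 2 * N powr (1 / p) \<le> lpnorm p (seq_sum (\<lambda>j. V (x j n)) {..<N})"
    "lpnorm p (seq_sum (\<lambda>j. V (x j n)) {..<N}) \<le> (b + a) * N powr (1 / p)"
    using lpnorm_seq_sum_nearly_disjoint[OF _ _ _ _ disj, of "\<lambda>j. V (x j n)" e b a]
      Vx_lp Vx_ge Vx_le z_lp close e_pos N_e \<open>0 < N\<close> \<open>0 < b\<close>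
    by (simp_all add: less_imp_le lessThan_empty_iff)
  ultimately show ?thesis
    by (intro exI[of _ n]) simp
qed

lemma intertwiner_diag_exponent:
  fixes x :: "nat \<Rightarrow> nat \<Rightarrow> nat \<Rightarrow> seq"
  assumes intertwines: "intertwiner p (\<lambda>f. diag_op (f \<circ> t)) \<rho> V" and dense: "dense_points t"
    and t_inj: "inj t"
    and eigensequences: "\<And>N j. j < N \<Longrightarrow> eigensequence p \<rho> (t j) (x N j)"
    and "0 < c"
    and growth_ge: "\<And>N n. c * real N powr s \<le> lpnorm p (seq_sum (\<lambda>j. x N j n) {..<N})"
    and growth_le: "\<And>N n. lpnorm p (seq_sum (\<lambda>j. x N j n) {..<N}) \<le> C * real N powr s"
  shows "s = 1 / p"
proof -
  obtain a where a_pos: "0 < a" and V_ge: "\<And>u. u \<in> lp p \<Longrightarrow> a * lpnorm p u \<le> lpnorm p (V u)"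
    and bounded_V: "bounded_op p V"
    using intertwines unfolding intertwiner_def bounded_below_def by blast
  obtain b where b_pos: "0 < b" and V_le: "lp_bounded_by p V b"
    using bounded_V by (rule bounded_opE)
  have "a / 2 * real N powr (1 / p) \<le> b * C * real N powr s \<and>
      a * c * real N powr s \<le> (b + a) * real N powr (1 / p)" if N_pos: "0 < N" for N
  proof -
    obtain n where n_ge: "a / 2 * N powr (1 / p) \<le> lpnorm p (V (seq_sum (\<lambda>j. x N j n) {..<N}))"
      and n_le: "lpnorm p (V (seq_sum (\<lambda>j. x N j n) {..<N})) \<le> (b + a) * N powr (1 / p)"
      using intertwiner_diag_sum_bounds[where x = "x N", OF intertwines dense t_inj
          eigensequences N_pos a_pos V_ge b_pos V_le] by blast
    have "seq_sum (\<lambda>j. x N j n) {..<N} \<in> lp p"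
      using eigensequences
      by (intro lp_seq_sum) (auto simp: eigensequence_def normalized_disjoint_def)
    note V_sum_ge = V_ge[OF this] and V_sum_le = lp_bounded_byD(2)[OF V_le this]
    have "a / 2 * real N powr (1 / p) \<le> b * (C * real N powr s)"
      using order_trans[OF n_ge order_trans[OF V_sum_le mult_left_mono[OF growth_le]]] b_pos by simp
    moreover have "a * (c * real N powr s) \<le> (b + a) * real N powr (1 / p)"
      using order_trans[OF mult_left_mono[OF growth_ge] order_trans[OF V_sum_ge n_le]] a_pos by simp
    ultimately show ?thesis
      by (simp add: mult.assoc)
  qed
  then have "1 / p \<le> s" "s \<le> 1 / p"
    using powr_exponent_le[of "a / 2" "1 / p" "b * C" s]
      powr_exponent_le[of "a * c" s "b + a" "1 / p"] a_pos \<open>0 < c\<close> by auto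
  then show ?thesis
    by simp
qed

lemma no_intertwiner_diag_rademacher:
  assumes "p \<noteq> 2" "dense_points t" "inj t"
  shows "\<not> intertwiner p (\<lambda>f. diag_op (f \<circ> t)) (\<lambda>f. rademacher_op (f \<circ> t)) V"
proof
  define q where "q = p / (p - 1)"
  assume "intertwiner p (\<lambda>f. diag_op (f \<circ> t)) (\<lambda>f. rademacher_op (f \<circ> t)) V"
  then have "1 / 2 = 1 / p"
  proof (rule intertwiner_diag_exponent[OF _ assms(2,3),
        where x = "\<lambda>N j n. rademacher_vec p (N + n) j"])
    have const_pos: "0 < khintchine_const q"
      using khintchine_const_pos[of q] p_gt_1 by (simp add: q_def)
    then show "0 < 1 / khintchine_const q"
      by simp
    fix N n
    let ?S = "seq_sum (\<lambda>j. rademacher_vec p (N + n) j) {..<N}"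
    show "1 / khintchine_const q * real N powr (1 / 2) \<le> lpnorm p ?S"
      using lpnorm_seq_sum_rademacher_vec(2)[of N "N + n"] const_pos
      by (simp add: q_def field_simps)
    show "lpnorm p ?S \<le> khintchine_const p * real N powr (1 / 2)"
      using lpnorm_seq_sum_rademacher_vec(1)[of N "N + n"] by simp
  qed (simp add: eigensequence_def normalized_disjoint_rademacher_vec rademacher_op_rademacher_vec)
  then show False
    using assms(1) by simp
qed

end

theorem theorem5p22:
  fixes p :: real
  assumes "1 < p" and "p \<noteq> 2"
  shows "\<exists>\<phi>1 \<phi>2. trivial_ext p \<phi>1 \<and> trivial_ext p \<phi>2 \<and> \<not> ext_equiv p \<phi>1 \<phi>2 \<and>
           (\<forall>\<phi>3. iso_ext p \<phi>3 \<longrightarrow> \<not> ext_equiv p \<phi>1 (ext_sum p \<phi>2 \<phi>3))"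
proof -
  interpret lp_space p
    by unfold_locales (rule assms(1))
  obtain t where t_inj: "inj t" and t_dense: "dense_points t"
    using ex_inj_dense_points by blast
  define \<rho>1 where "\<rho>1 = (\<lambda>f :: real \<Rightarrow> complex. diag_op (f \<circ> t))"
  define \<rho>2 where "\<rho>2 = (\<lambda>f :: real \<Rightarrow> complex. rademacher_op (f \<circ> t))"
  have bounded: "bounded_op p (\<rho>1 f)" "bounded_op p (\<rho>2 f)" if "f \<in> C01" for f
    using diag.bounded_op_sample[OF t_dense that] rademacher.bounded_op_sample[OF t_dense that]
    by (simp_all add: \<rho>1_def \<rho>2_def)
  have no_intertwiner: "\<nexists>V. intertwiner p \<rho>1 \<rho>2 V"
    unfolding \<rho>1_def \<rho>2_def using no_intertwiner_diag_rademacher[OF assms(2) t_dense t_inj] by blast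
  have "trivial_ext p (\<lambda>f. calkin_pi p (\<rho>1 f))" "trivial_ext p (\<lambda>f. calkin_pi p (\<rho>2 f))"
    unfolding \<rho>1_def \<rho>2_def using t_dense
    by (rule diag.trivial_ext_sample rademacher.trivial_ext_sample)+
  moreover have "\<not> ext_equiv p (\<lambda>f. calkin_pi p (\<rho>1 f)) (\<lambda>f. calkin_pi p (\<rho>2 f))"
    using ext_equiv_imp_intertwiner[of \<rho>1 \<rho>2, OF bounded] no_intertwiner by blast
  moreover have "\<not> ext_equiv p (\<lambda>f. calkin_pi p (\<rho>1 f)) (ext_sum p (\<lambda>f. calkin_pi p (\<rho>2 f)) \<phi>3)"
    if "iso_ext p \<phi>3" for \<phi>3
    using ext_equiv_sum_imp_intertwiner[of \<rho>1 \<rho>2, OF bounded that] no_intertwiner by blast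
  ultimately show ?thesis
    by blast
qed

end
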